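(* Let $G$ be an infinite, connected, vertex-transitive graph with all degrees at most a finite constant $D$, and let $o$ be any vertex of $G$. Then the matching measure $\nu_{G,o}$ has no atoms, that is, $\nu_{G,o}(\{\theta\})=0$ for every $\theta\in\mathbb{R}$.
   Context: For a graph $G$ of maximum degree at most $D$ and a vertex $u$, let $\mathcal{P}(u)$ be the set of finite paths in $G$ (sequences of distinct vertices, consecutive ones adjacent) starting at $u$. The path tree $T(G,u)$ has vertex set $\mathcal{P}(u)$, two paths being adjacent iff one is obtained from the other by deleting its last vertex. Let $A$ be the adjacency operator of $T(G,u)$ on $\ell^2(\mathcal{P}(u))$ (bounded, self-adjoint) and $\chi_u$ the indicator of the one-vertex path $u$. The matching measure $\nu_{G,u}$ is the unique probability measure on $[-D,D]$ with $\langle A^n\chi_u,\chi_u\rangle=\int x^n\,d\nu_{G,u}(x)$ for all $n\ge 1$. *)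

theory Defs
  imports "HOL-Probability.Probability"
begin

definition simple_graph :: "('a \<Rightarrow> 'a \<Rightarrow> bool) \<Rightarrow> bool" where
  "simple_graph E \<longleftrightarrow> (\<forall>x y. E x y \<longrightarrow> E y x) \<and> (\<forall>x. \<not> E x x)"

definition degree_bounded :: "('a \<Rightarrow> 'a \<Rightarrow> bool) \<Rightarrow> nat \<Rightarrow> bool" where
  "degree_bounded E D \<longleftrightarrow> (\<forall>x. finite {y. E x y} \<and> card {y. E x y} \<le> D)"

definition connected_graph :: "('a \<Rightarrow> 'a \<Rightarrow> bool) \<Rightarrow> bool" where
  "connected_graph E \<longleftrightarrow> (\<forall>x y. E\<^sup>*\<^sup>* x y)"

definition graph_automorphism :: "('a \<Rightarrow> 'a \<Rightarrow> bool) \<Rightarrow> ('a \<Rightarrow> 'a) \<Rightarrow> bool" where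
  "graph_automorphism E f \<longleftrightarrow> bij f \<and> (\<forall>x y. E x y \<longleftrightarrow> E (f x) (f y))"

definition vertex_transitive :: "('a \<Rightarrow> 'a \<Rightarrow> bool) \<Rightarrow> bool" where
  "vertex_transitive E \<longleftrightarrow> (\<forall>x y. \<exists>f. graph_automorphism E f \<and> f x = y)"

definition paths_from :: "('a \<Rightarrow> 'a \<Rightarrow> bool) \<Rightarrow> 'a \<Rightarrow> 'a list set" where
  "paths_from E u = {p. p \<noteq> [] \<and> hd p = u \<and> distinct p \<and>
      (\<forall>i. Suc i < length p \<longrightarrow> E (p ! i) (p ! Suc i))}"

definition path_tree_adj :: "'a list \<Rightarrow> 'a list \<Rightarrow> bool" where
  "path_tree_adj p q \<longleftrightarrow> (\<exists>x. q = p @ [x]) \<or> (\<exists>x. p = q @ [x])"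

text \<open>Closed walks of length n in the path tree T(G,u) from the root [u] back to [u].
  The n-th moment of the adjacency operator A at the root, i.e. the inner product of
  A^n chi_u with chi_u, is the number of such walks.\<close>

definition path_tree_closed_walks :: "('a \<Rightarrow> 'a \<Rightarrow> bool) \<Rightarrow> 'a \<Rightarrow> nat \<Rightarrow> 'a list list set" where
  "path_tree_closed_walks E u n = {w. length w = Suc n \<and> set w \<subseteq> paths_from E u \<and>
      w ! 0 = [u] \<and> w ! n = [u] \<and>
      (\<forall>i<n. path_tree_adj (w ! i) (w ! Suc i))}"

definition path_tree_moment :: "('a \<Rightarrow> 'a \<Rightarrow> bool) \<Rightarrow> 'a \<Rightarrow> nat \<Rightarrow> real" where
  "path_tree_moment E u n = real (card (path_tree_closed_walks E u n))"

definition matching_measure :: "('a \<Rightarrow> 'a \<Rightarrow> bool) \<Rightarrow> nat \<Rightarrow> 'a \<Rightarrow> real measure" where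
  "matching_measure E D u = (THE M. prob_space M \<and> sets M = sets borel \<and>
      emeasure M {- real D .. real D} = 1 \<and>
      (\<forall>n\<ge>1. (\<integral>x. x ^ n \<partial>M) = path_tree_moment E u n))"

end

theory Submission
  imports Defs
begin

text \<open>
  For a finite vertex set \<open>S\<close> let \<open>R(S, v) = \<mu>(S - v) / \<mu>(S)\<close> be the ratio of matching polynomials at
  \<open>\<theta> + i t\<close>; by Godsil it is the root entry of the resolvent of the path tree of \<open>S\<close> at \<open>v\<close>. If the
  matching measure has an atom at \<open>\<theta>\<close> of mass \<open>c\<close>, then by transitivity \<open>- t Im R(S, v)\<close> is at least about
  \<open>c\<close> for every vertex \<open>v\<close> as soon as \<open>S\<close> is large. As in Gallai's lemma, this forces
  \<open>t R(S - u, v)\<close> to vanish as \<open>t\<close> tends to \<open>0\<close>, for all \<open>v \<noteq> u\<close>: for neighbours of \<open>u\<close> by the recursion for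
  \<open>1 / R\<close>, and along an edge \<open>v w\<close> by a Heilmann--Lieb type identity for three vertices
  together with Cauchy--Schwarz over paths. On the other hand the two-vertex identity and
  \<open>t \<Sum>\<^sub>p \<bar>\<mu>(S - p) / \<mu>(S)\<bar>\<^sup>2 = - Im R(S, u)\<close> bound \<open>t\<^sup>2 \<bar>R(S, u)\<bar> \<Sum>\<^sub>v \<bar>R(S, v) - R(S - u, v)\<bar>\<close> by \<open>1\<close>, so
  only finitely many vertices can have an atom of mass \<open>c\<close>.
\<close>

section \<open>Matching polynomials and paths\<close>

text \<open>Finite \<open>S\<close> are forced: the identities for two and three vertices are
  polynomial identities in \<mu>, and deleting \<open>u\<close> destroys transitivity, so R(S - u,
  v) can only be controlled through them and not by symmetry. The atom enters through t * - Im R =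
  integral of t^2 / ((x - \<theta>)^2 + t^2), which is at least the mass at \<theta>. For fixed t
  this integrand is close to a polynomial, and finitely many moments see only a ball of the path
  tree, so a finite \<open>S\<close> chosen after t inherits the bound up to a small error. The
  scaling to keep in mind is t |R| \<le> 1 always, and t |R| \<ge> c where there is an atom. Each
  step along an edge replaces a small bound \<open>a\<close> by roughly its square root; this is
  harmless because a fixed vertex is reached from \<open>u\<close> in a fixed number of steps. Since
  \<open>matching_measure\<close> is a definite description, the moment problem must be solved
  before anything can be said about it. Existence goes through Bernstein weights, whose positivity
  is checked in finite trees by algebra from the operator norm bound D; uniqueness goes through
  polynomial approximation and characteristic functions.\<close>

definition matchings :: "('a \<Rightarrow> 'a \<Rightarrow> bool) \<Rightarrow> 'a set \<Rightarrow> 'a set set set" where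
  "matchings E S = {M. (\<forall>e\<in>M. \<exists>x\<in>S. \<exists>y\<in>S. E x y \<and> e = {x, y}) \<and> disjoint M}"

definition matching_poly :: "('a \<Rightarrow> 'a \<Rightarrow> bool) \<Rightarrow> 'b::comm_ring_1 \<Rightarrow> 'a set \<Rightarrow> 'b" where
  "matching_poly E z S = (\<Sum>M\<in>matchings E S. (- 1) ^ card M * z ^ card (S - \<Union>M))"

lemma finite_matchings: "finite S \<Longrightarrow> finite (matchings E S)"
  by (rule finite_subset[of _ "Pow (Pow S)"]) (auto simp: matchings_def)

lemma Union_matching_subset: "M \<in> matchings E S \<Longrightarrow> \<Union>M \<subseteq> S"
  by (fastforce simp: matchings_def)

lemma matchings_empty [simp]: "matchings E {} = {{}}"
  by (auto simp: matchings_def disjoint_def)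

lemma matching_poly_empty [simp]: "matching_poly E z {} = 1"
  by (simp add: matching_poly_def)

lemma matching_edge: "M \<in> matchings E S \<Longrightarrow> e \<in> M \<Longrightarrow> \<exists>x\<in>S. \<exists>y\<in>S. E x y \<and> e = {x, y}"
  by (simp add: matchings_def)

lemma matchings_mono: "S \<subseteq> T \<Longrightarrow> matchings E S \<subseteq> matchings E T"
  unfolding matchings_def by blast

text \<open>Either \<open>u\<close> is uncovered, or disjointness makes the edge covering it unique,
  and removing that edge leaves a matching that avoids both of its ends.\<close>

lemma matchings_split:
  assumes "simple_graph E" "u \<in> S"
  shows "matchings E S = matchings E (S - {u}) \<union>
    (\<Union>v\<in>{v\<in>S - {u}. E u v}. insert {u, v} ` matchings E (S - {u} - {v}))" (is "_ = ?A \<union> ?B")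
proof (intro equalityI subsetI)
  fix M assume M: "M \<in> matchings E S"
  have disj: "disjoint M" using M by (simp add: matchings_def)
  show "M \<in> ?A \<union> ?B"
  proof (cases "u \<in> \<Union>M")
    case False
    have "\<exists>x\<in>S - {u}. \<exists>y\<in>S - {u}. E x y \<and> e = {x, y}" if e: "e \<in> M" for e
    proof -
      obtain x y where "x \<in> S" "y \<in> S" "E x y" "e = {x, y}" using matching_edge[OF M e] by auto
      moreover have "u \<notin> e" using False e by auto
      ultimately show ?thesis by auto
    qed
    then have "M \<in> ?A" using disj by (simp add: matchings_def)
    then show ?thesis by auto
  next
    case True
    then obtain e where e: "e \<in> M" "u \<in> e" by auto
    obtain x y where xy: "x \<in> S" "y \<in> S" "E x y" "e = {x, y}" using matching_edge[OF M e(1)] by auto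
    have "E y x" "x \<noteq> y" using assms(1) xy(3) unfolding simple_graph_def by metis+
    then obtain v where v: "v \<in> S - {u}" "E u v" "e = {u, v}"
      using e(2) xy by (cases "u = x") (auto simp: insert_commute)
    have "\<exists>x\<in>S - {u} - {v}. \<exists>y\<in>S - {u} - {v}. E x y \<and> f = {x, y}" if f: "f \<in> M - {e}" for f
    proof -
      obtain x y where "x \<in> S" "y \<in> S" "E x y" "f = {x, y}" using matching_edge[OF M, of f] f by auto
      moreover have "f \<inter> e = {}" using disj e f by (auto simp: disjoint_def)
      ultimately show ?thesis using v by auto
    qed
    moreover have "disjoint (M - {e})" using disj by (auto simp: disjoint_def)
    ultimately have "M - {e} \<in> matchings E (S - {u} - {v})" by (simp add: matchings_def)
    moreover have "M = insert {u, v} (M - {e})" using e v by auto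
    ultimately show ?thesis using v by blast
  qed
next
  fix M assume "M \<in> ?A \<union> ?B"
  then show "M \<in> matchings E S"
  proof
    assume "M \<in> ?A" then show ?thesis using matchings_mono[of "S - {u}" S] by blast
  next
    assume "M \<in> ?B"
    then obtain v N where v: "v \<in> S - {u}" "E u v" and N: "N \<in> matchings E (S - {u} - {v})"
      and M: "M = insert {u, v} N" by auto
    have NS: "N \<in> matchings E S" using N matchings_mono[of "S - {u} - {v}" S] by blast
    have "\<Union>N \<inter> {u, v} = {}" using Union_matching_subset[OF N] by auto
    then have "e \<inter> {u, v} = {}" if "e \<in> N" for e using that by auto
    moreover have "disjoint N" using NS by (simp add: matchings_def)
    ultimately have "disjoint M" unfolding M disjoint_def by (simp add: Int_commute)
    moreover have "\<exists>x\<in>S. \<exists>y\<in>S. E x y \<and> e = {x, y}" if "e \<in> M" for e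
      using that matching_edge[OF NS] v assms(2) by (cases "e = {u, v}") (auto simp: M)
    ultimately show ?thesis by (simp add: matchings_def)
  qed
qed

text \<open>Matchings are sorted by the partner of \<open>u\<close>: an uncovered \<open>u\<close>
  contributes a factor \<open>z\<close>, an edge at \<open>u\<close> a sign. Divided by \<mu>(S - u)
  this is the recursion 1 / R(S, u) = z - sum of R(S - u, v) over the neighbours v.\<close>

lemma matching_poly_remove:
  assumes E: "simple_graph E" and S: "finite S" "u \<in> S"
  shows "matching_poly E z S = z * matching_poly E z (S - {u})
    - (\<Sum>v | v \<in> S - {u} \<and> E u v. matching_poly E z (S - {u} - {v}))"
proof -
  let ?N = "{v\<in>S - {u}. E u v}"
  let ?f = "\<lambda>M. (- 1) ^ card M * z ^ card (S - \<Union>M)"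
  have notin: "u \<notin> \<Union>M" if "M \<in> matchings E (S - {u})" for M
    using Union_matching_subset[OF that] by auto
  have notin2: "{u, v} \<notin> M" if "M \<in> matchings E (S - {u} - {v})" for M v
    using Union_matching_subset[OF that] by auto
  have fin: "finite (insert {u, v} ` matchings E (S - {u} - {v}))" for v
    using S by (intro finite_imageI finite_matchings) auto
  have "(\<Sum>M\<in>matchings E (S - {u}). ?f M) = z * matching_poly E z (S - {u})"
    unfolding matching_poly_def sum_distrib_left
  proof (rule sum.cong[OF refl])
    fix M assume M: "M \<in> matchings E (S - {u})"
    have "S - \<Union>M = insert u (S - {u} - \<Union>M)" using notin[OF M] S by auto
    then have "card (S - \<Union>M) = Suc (card (S - {u} - \<Union>M))" using S by simp
    then show "?f M = z * ((- 1) ^ card M * z ^ card (S - {u} - \<Union>M))" by (simp add: mult_ac)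
  qed
  moreover have "(\<Sum>M\<in>insert {u, v} ` matchings E (S - {u} - {v}). ?f M)
      = - matching_poly E z (S - {u} - {v})" if v: "v \<in> ?N" for v
  proof -
    have "inj_on (insert {u, v}) (matchings E (S - {u} - {v}))"
      using notin2[of _ v] by (intro inj_onI) (metis Diff_insert_absorb)
    then have "(\<Sum>M\<in>insert {u, v} ` matchings E (S - {u} - {v}). ?f M)
      = (\<Sum>M\<in>matchings E (S - {u} - {v}). ?f (insert {u, v} M))" by (simp add: sum.reindex)
    also have "\<dots> = (\<Sum>M\<in>matchings E (S - {u} - {v}). - ((- 1) ^ card M * z ^ card (S - {u} - {v} - \<Union>M)))"
    proof (rule sum.cong[OF refl])
      fix M assume M: "M \<in> matchings E (S - {u} - {v})"
      have "finite M" using finite_UnionD[OF finite_subset[OF Union_matching_subset[OF M]]] S by auto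
      moreover have "S - \<Union>(insert {u, v} M) = S - {u} - {v} - \<Union>M" by auto
      ultimately show "?f (insert {u, v} M) = - ((- 1) ^ card M * z ^ card (S - {u} - {v} - \<Union>M))"
        using notin2[OF M] by (simp add: card_insert_disjoint)
    qed
    finally show ?thesis by (simp add: matching_poly_def sum_negf)
  qed
  moreover have "matching_poly E z S = (\<Sum>M\<in>matchings E (S - {u}). ?f M)
      + (\<Sum>M\<in>(\<Union>v\<in>?N. insert {u, v} ` matchings E (S - {u} - {v})). ?f M)"
    unfolding matching_poly_def matchings_split[OF E S(2)]
  proof (rule sum.union_disjoint)
    show "finite (\<Union>v\<in>?N. insert {u, v} ` matchings E (S - {u} - {v}))"
      using S by (intro finite_UN_I fin) auto
    show "matchings E (S - {u}) \<inter> (\<Union>v\<in>?N. insert {u, v} ` matchings E (S - {u} - {v})) = {}"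
      using notin by fastforce
  qed (use S in \<open>auto intro: finite_matchings\<close>)
  moreover have "(\<Sum>M\<in>(\<Union>v\<in>?N. insert {u, v} ` matchings E (S - {u} - {v})). ?f M)
      = (\<Sum>v\<in>?N. \<Sum>M\<in>insert {u, v} ` matchings E (S - {u} - {v}). ?f M)"
  proof (rule sum.UNION_disjoint)
    show "\<forall>v\<in>?N. \<forall>w\<in>?N. v \<noteq> w \<longrightarrow> insert {u, v} ` matchings E (S - {u} - {v})
      \<inter> insert {u, w} ` matchings E (S - {u} - {w}) = {}"
    proof (intro ballI impI, rule ccontr)
      fix v w assume *: "v \<in> ?N" "w \<in> ?N" "v \<noteq> w" and
        "insert {u, v} ` matchings E (S - {u} - {v}) \<inter> insert {u, w} ` matchings E (S - {u} - {w}) \<noteq> {}"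
      then obtain M M' where "insert {u, v} M = insert {u, w} M'" "M \<in> matchings E (S - {u} - {v})"
        by auto
      moreover have "{u, w} \<noteq> {u, v}" using * by (auto simp: doubleton_eq_iff)
      ultimately have "{u, w} \<in> M" by (metis insertE insertI1)
      then show False
        using Union_matching_subset[OF \<open>M \<in> matchings E (S - {u} - {v})\<close>] by auto
    qed
  qed (use S fin in auto)
  ultimately show ?thesis by (simp add: sum_negf)
qed

section \<open>Self-avoiding paths inside a vertex set\<close>

definition paths_in :: "('a \<Rightarrow> 'a \<Rightarrow> bool) \<Rightarrow> 'a set \<Rightarrow> 'a \<Rightarrow> 'a list set" where
  "paths_in E S v = {p \<in> paths_from E v. set p \<subseteq> S}"

lemma finite_paths_in: "finite S \<Longrightarrow> finite (paths_in E S v)"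
  by (rule finite_subset[OF _ finite_subset_distinct[of S]])
     (auto simp: paths_in_def paths_from_def)

lemma all_nat_iff: "(\<forall>i::nat. P i) \<longleftrightarrow> P 0 \<and> (\<forall>i. P (Suc i))"
  by (metis not0_implies_Suc)

lemma Cons_in_paths_from:
  "v # p \<in> paths_from E u \<longleftrightarrow>
    v = u \<and> v \<notin> set p \<and> (p = [] \<or> (\<exists>x. E v x \<and> p \<in> paths_from E x))"
proof (cases p)
  case Nil
  then show ?thesis by (auto simp: paths_from_def)
next
  case (Cons y q)
  have "(\<forall>i. Suc i < length (v # p) \<longrightarrow> E ((v # p) ! i) ((v # p) ! Suc i)) \<longleftrightarrow>
        E v y \<and> (\<forall>i. Suc i < length p \<longrightarrow> E (p ! i) (p ! Suc i))"
    unfolding Cons by (subst (1) all_nat_iff) simp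
  then show ?thesis unfolding paths_from_def Cons by auto
qed

lemma paths_in_Cons:
  assumes "v \<in> S"
  shows "paths_in E S v = insert [v] (\<Union>x\<in>{x\<in>S - {v}. E v x}. (#) v ` paths_in E (S - {v}) x)"
proof (intro equalityI subsetI)
  fix p assume p: "p \<in> paths_in E S v"
  then obtain a q where "p = a # q" by (cases p) (auto simp: paths_in_def paths_from_def)
  moreover have "q = [] \<or> (\<exists>x\<in>S - {v}. E v x \<and> q \<in> paths_in E (S - {v}) x)"
    using p \<open>p = a # q\<close> by (cases q) (auto simp: paths_in_def Cons_in_paths_from)
  ultimately show "p \<in> insert [v] (\<Union>x\<in>{x\<in>S - {v}. E v x}. (#) v ` paths_in E (S - {v}) x)"
    using p by (auto simp: paths_in_def Cons_in_paths_from)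
next
  fix p assume "p \<in> insert [v] (\<Union>x\<in>{x\<in>S - {v}. E v x}. (#) v ` paths_in E (S - {v}) x)"
  then show "p \<in> paths_in E S v" using assms
    by (auto simp: paths_in_def Cons_in_paths_from)
qed

text \<open>Peeling off the first vertex of a path mirrors \<open>matching_poly_remove\<close>, so
  inductions over \<open>S\<close> can run on both at once.\<close>

lemma sum_paths_in:
  assumes "finite S" "v \<in> S"
  shows "(\<Sum>p\<in>paths_in E S v. f p) =
    f [v] + (\<Sum>x | x \<in> S - {v} \<and> E v x. \<Sum>q\<in>paths_in E (S - {v}) x. f (v # q))"
proof -
  let ?N = "{x\<in>S - {v}. E v x}"
  have fin: "finite (paths_in E (S - {v}) x)" for x using assms by (simp add: finite_paths_in)
  have "(\<Sum>p\<in>paths_in E S v. f p) = f [v] + (\<Sum>p\<in>(\<Union>x\<in>?N. (#) v ` paths_in E (S - {v}) x). f p)"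
    unfolding paths_in_Cons[OF assms(2)] using assms(1) fin
    by (subst sum.insert) (auto simp: paths_in_def paths_from_def)
  also have "(\<Sum>p\<in>(\<Union>x\<in>?N. (#) v ` paths_in E (S - {v}) x). f p)
    = (\<Sum>x\<in>?N. \<Sum>p\<in>(#) v ` paths_in E (S - {v}) x. f p)"
    using assms(1) fin by (intro sum.UNION_disjoint) (auto simp: paths_in_def paths_from_def)
  also have "\<dots> = (\<Sum>x\<in>?N. \<Sum>q\<in>paths_in E (S - {v}) x. f (v # q))"
    by (simp add: sum.reindex)
  finally show ?thesis .
qed

text \<open>The Heilmann--Lieb identity is the case where \<open>W\<close> is a singleton.\<close>

lemma matching_poly_path_identity:
  assumes E: "simple_graph E" and "finite S" "v \<in> S" "W \<subseteq> S - {v}"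
  shows "matching_poly E z (S - {v}) * matching_poly E z (S - W)
      - matching_poly E z S * matching_poly E z (S - {v} - W) =
    (\<Sum>p\<in>paths_in E S v. if set p \<inter> W = {last p}
      then matching_poly E z (S - set p) * matching_poly E z (S - set p - W) else 0)"
  using assms(2-4)
proof (induction "card S" arbitrary: S v)
  case 0
  then show ?case by simp
next
  case (Suc n)
  let ?m = "matching_poly E z" and ?H = "S - {v}"
  \<comment> \<open>The condition on \<open>p\<close> says that it ends at its first visit to
    \<open>W\<close>.\<close>
  let ?f = "\<lambda>S p. if set p \<inter> W = {last p} then ?m (S - set p) * ?m (S - set p - W) else 0"
  let ?N = "{x\<in>?H. E v x}"
  have fN: "finite ?N" using Suc.prems by simp
  have W: "W \<subseteq> S" "v \<notin> W" using Suc.prems by auto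
  \<comment> \<open>Both \<mu>(S) and \<mu>(S - W) are expanded at \<open>v\<close>; the terms with
    factor \<open>z\<close> cancel in the difference.\<close>
  have 1: "?m S = z * ?m ?H - (\<Sum>x\<in>?N. ?m (?H - {x}))"
    using matching_poly_remove[OF E] Suc.prems by blast
  have "?m (S - W) = z * ?m (S - W - {v}) - (\<Sum>x | x \<in> S - W - {v} \<and> E v x. ?m (S - W - {v} - {x}))"
    using matching_poly_remove[OF E, of "S - W" v] Suc.prems W by simp
  moreover have "S - W - {v} = ?H - W" "{x. x \<in> S - W - {v} \<and> E v x} = ?N - W" by auto
  moreover have "?H - W - {x} = ?H - {x} - W" for x by auto
  ultimately have 2: "?m (S - W) = z * ?m (?H - W) - (\<Sum>x\<in>?N - W. ?m (?H - {x} - W))"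
    by presburger
  have "?m ?H * ?m (S - W) - ?m S * ?m (?H - W)
      = (\<Sum>x\<in>?N. ?m (?H - {x}) * ?m (?H - W)) - (\<Sum>x\<in>?N - W. ?m ?H * ?m (?H - {x} - W))"
    unfolding 1 2 by (simp add: algebra_simps sum_distrib_left sum_distrib_right)
  also have "(\<Sum>x\<in>?N. ?m (?H - {x}) * ?m (?H - W)) =
     (\<Sum>x\<in>?N - W. ?m (?H - {x}) * ?m (?H - W)) + (\<Sum>x\<in>?N \<inter> W. ?m (?H - {x}) * ?m (?H - W))"
    using sum.Int_Diff[OF fN, of _ W] by (simp add: add.commute)
  also have "\<dots> - (\<Sum>x\<in>?N - W. ?m ?H * ?m (?H - {x} - W)) =
     (\<Sum>x\<in>?N - W. ?m (?H - {x}) * ?m (?H - W) - ?m ?H * ?m (?H - {x} - W))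
     + (\<Sum>x\<in>?N \<inter> W. ?m (?H - {x}) * ?m (?H - W))" by (simp add: sum_subtractf)
  \<comment> \<open>A neighbour outside \<open>W\<close> gives an instance of the claim for
    \<open>S - {v}\<close>.\<close>
  also have "(\<Sum>x\<in>?N - W. ?m (?H - {x}) * ?m (?H - W) - ?m ?H * ?m (?H - {x} - W))
     = (\<Sum>x\<in>?N - W. \<Sum>p\<in>paths_in E ?H x. ?f ?H p)"
  proof (rule sum.cong[OF refl])
    fix x assume "x \<in> ?N - W"
    moreover have "n = card ?H" using Suc by simp
    ultimately show "?m (?H - {x}) * ?m (?H - W) - ?m ?H * ?m (?H - {x} - W)
       = (\<Sum>p\<in>paths_in E ?H x. ?f ?H p)" using Suc.prems by (intro Suc.hyps(1)) auto
  qed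
  \<comment> \<open>A neighbour \<open>x\<close> in \<open>W\<close> already ends the path: a longer
    path from \<open>x\<close> meets \<open>W\<close> at \<open>x\<close>, which is not its last
    vertex, and so contributes 0.\<close>
  also have "(\<Sum>x\<in>?N \<inter> W. ?m (?H - {x}) * ?m (?H - W)) =
     (\<Sum>x\<in>?N \<inter> W. \<Sum>p\<in>paths_in E ?H x. ?f ?H p)"
  proof (rule sum.cong[OF refl])
    fix x assume x: "x \<in> ?N \<inter> W"
    have "set p \<inter> W \<noteq> {last p}" if p: "p \<in> paths_in E ?H x" "p \<noteq> [x]" for p
    proof -
      obtain q where "p = x # q" "q \<noteq> []" "x \<notin> set q"
        using p by (cases p) (auto simp: paths_in_def paths_from_def)
      then show ?thesis using x last_in_set[of q] by auto
    qed
    then have "(\<Sum>p\<in>paths_in E ?H x. ?f ?H p) = (\<Sum>p\<in>{[x]}. ?f ?H p)"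
      using x Suc.prems
      by (intro sum.mono_neutral_right finite_paths_in) (auto simp: paths_in_def paths_from_def)
    moreover have "?H - {x} - W = ?H - W" "{x} \<inter> W = {x}" using x by auto
    ultimately show "?m (?H - {x}) * ?m (?H - W) = (\<Sum>p\<in>paths_in E ?H x. ?f ?H p)" by simp
  qed
  also have "(\<Sum>x\<in>?N - W. \<Sum>p\<in>paths_in E ?H x. ?f ?H p) + (\<Sum>x\<in>?N \<inter> W. \<Sum>p\<in>paths_in E ?H x. ?f ?H p)
     = (\<Sum>x\<in>?N. \<Sum>p\<in>paths_in E ?H x. ?f ?H p)"
    by (rule trans[OF add.commute sum.Int_Diff[OF fN, symmetric]])
  also have "\<dots> = (\<Sum>x\<in>?N. \<Sum>p\<in>paths_in E ?H x. ?f S (v # p))"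
  proof (intro sum.cong[OF refl])
    fix x p assume "p \<in> paths_in E ?H x"
    then have "p \<noteq> []" by (auto simp: paths_in_def paths_from_def)
    moreover have "S - insert v (set p) = ?H - set p" by auto
    ultimately show "?f ?H p = ?f S (v # p)" using W by simp
  qed
  also have "\<dots> = (\<Sum>p\<in>paths_in E S v. ?f S p)"
    using W by (subst sum_paths_in) (use Suc.prems in auto)
  finally show ?case .
qed

section \<open>Green's functions of finite subgraphs\<close>

text \<open>For the resolvent column g(p) = \<mu>(S - p) / \<mu>(S) of the path tree this is the
  identity \<open>Im z\<close> * ||g||^2 = - Im g(root). It is multiplied by |\<mu>(S)|^2 so that it
  makes sense before \<mu>(S) is known to be nonzero.\<close>

lemma path_norm_sum:
  assumes E: "simple_graph E" and "finite S" "v \<in> S"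
  shows "Im z * (\<Sum>p\<in>paths_in E S v. (cmod (matching_poly E z (S - set p)))\<^sup>2)
    = - Im (matching_poly E z (S - {v}) * cnj (matching_poly E z S))"
  using assms(2,3)
proof (induction "card S" arbitrary: S v)
  case 0
  then show ?case by simp
next
  case (Suc n)
  let ?m = "matching_poly E z" and ?H = "S - {v}"
  let ?N = "{x. x \<in> ?H \<and> E v x}"
  have IH: "Im z * (\<Sum>p\<in>paths_in E ?H x. (cmod (?m (?H - set p)))\<^sup>2)
      = - Im (?m (?H - {x}) * cnj (?m ?H))" if "x \<in> ?N" for x
    using that Suc.prems Suc.hyps(2) by (intro Suc.hyps(1)) auto
  have S: "S - set (v # q) = ?H - set q" for q by auto
  have "Im z * (\<Sum>p\<in>paths_in E S v. (cmod (?m (S - set p)))\<^sup>2) =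
    Im z * (cmod (?m ?H))\<^sup>2 + (\<Sum>x\<in>?N. Im z * (\<Sum>p\<in>paths_in E ?H x. (cmod (?m (?H - set p)))\<^sup>2))"
    unfolding sum_paths_in[OF Suc.prems] S by (simp add: distrib_left sum_distrib_left)
  also have "\<dots> = Im z * (cmod (?m ?H))\<^sup>2 + (\<Sum>x\<in>?N. - Im (?m (?H - {x}) * cnj (?m ?H)))"
    using IH by simp
  also have "\<dots> = - Im (?m ?H * cnj (z * ?m ?H - (\<Sum>x\<in>?N. ?m (?H - {x}))))"
    unfolding cmod_power2
    by (simp add: algebra_simps sum_distrib_left sum_negf sum.distrib sum_subtractf power2_eq_square)
  also have "z * ?m ?H - (\<Sum>x\<in>?N. ?m (?H - {x})) = ?m S"
    using matching_poly_remove[OF E Suc.prems, of z] by simp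
  finally show ?case .
qed

text \<open>The Heilmann--Lieb theorem on real zeros, for the upper half plane. The one-vertex path
  contributes |\<mu>(S - v)|^2 > 0 to \<open>path_norm_sum\<close> by induction, so the right side
  there cannot vanish.\<close>

lemma matching_poly_nonzero:
  assumes E: "simple_graph E" and "finite S" "Im z > 0"
  shows "matching_poly E z S \<noteq> 0"
  using assms(2)
proof (induction S rule: finite_induct)
  case empty
  then show ?case by simp
next
  case (insert v S)
  let ?S = "insert v S"
  have "[v] \<in> paths_in E ?S v" by (simp add: paths_in_def Cons_in_paths_from)
  then have "(cmod (matching_poly E z (?S - set [v])))\<^sup>2 \<le>
      (\<Sum>p\<in>paths_in E ?S v. (cmod (matching_poly E z (?S - set p)))\<^sup>2)"
    using insert.hyps by (intro member_le_sum finite_paths_in) auto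
  moreover have "?S - set [v] = S" using insert.hyps by auto
  ultimately have "0 < (\<Sum>p\<in>paths_in E ?S v. (cmod (matching_poly E z (?S - set p)))\<^sup>2)"
    using insert.IH by (smt (verit) zero_less_norm_iff zero_less_power)
  then have "0 < - Im (matching_poly E z (?S - {v}) * cnj (matching_poly E z ?S))"
    using assms(3) insert.hyps by (subst path_norm_sum[OF E, symmetric]) (auto intro!: mult_pos_pos)
  then show ?case by auto
qed

text \<open>This is R(S, v) of the overview. For \<open>v \<notin> S\<close> and nonzero \<mu>(S)
  the quotient is 1 and not a resolvent entry.\<close>

definition green :: "('a \<Rightarrow> 'a \<Rightarrow> bool) \<Rightarrow> complex \<Rightarrow> 'a set \<Rightarrow> 'a \<Rightarrow> complex" where
  "green E z S v = matching_poly E z (S - {v}) / matching_poly E z S"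

locale finite_subgraph =
  fixes E :: "'a \<Rightarrow> 'a \<Rightarrow> bool" and S :: "'a set" and z :: complex
  assumes simple: "simple_graph E" and finite_S: "finite S" and Im_z: "Im z > 0"
begin

lemma remove: "finite_subgraph E (S - T) z"
  using simple finite_S Im_z by unfold_locales auto

lemma nonzero: "matching_poly E z (S - T) \<noteq> 0" "matching_poly E z S \<noteq> 0"
  using matching_poly_nonzero[OF simple _ Im_z] finite_S by auto

lemma green_mult_green:
  "green E z S v * green E z (S - {v}) w = matching_poly E z (S - {v} - {w}) / matching_poly E z S"
  using nonzero by (simp add: green_def)

lemma path_norm_sum_green:
  assumes "v \<in> S"
  shows "Im z * (\<Sum>p\<in>paths_in E S v. (cmod (matching_poly E z (S - set p) / matching_poly E z S))\<^sup>2)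
    = - Im (green E z S v)"
proof -
  let ?m = "matching_poly E z"
  have "- Im (green E z S v) = - Im (?m (S - {v}) * cnj (?m S)) / (cmod (?m S))\<^sup>2"
    unfolding green_def complex_div_cnj[of "?m (S - {v})"] of_real_power[symmetric] Im_divide_of_real
    by (simp only: minus_divide_left)
  also have "\<dots> = Im z * (\<Sum>p\<in>paths_in E S v. (cmod (?m (S - set p)))\<^sup>2) / (cmod (?m S))\<^sup>2"
    by (simp only: path_norm_sum[OF simple finite_S assms])
  also have "\<dots> = Im z * (\<Sum>p\<in>paths_in E S v. (cmod (?m (S - set p) / ?m S))\<^sup>2)"
    by (simp add: norm_divide power_divide sum_divide_distrib[symmetric])
  finally show ?thesis ..
qed

lemma path_in_singleton: "v \<in> S \<Longrightarrow> [v] \<in> paths_in E S v"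
  by (simp add: paths_in_def Cons_in_paths_from)

text \<open>Only the one-vertex path is kept in \<open>path_norm_sum_green\<close>.\<close>

lemma norm_green_sq_le:
  assumes "v \<in> S"
  shows "Im z * (cmod (green E z S v))\<^sup>2 \<le> - Im (green E z S v)"
proof -
  have "(cmod (matching_poly E z (S - set [v]) / matching_poly E z S))\<^sup>2 \<le>
    (\<Sum>p\<in>paths_in E S v. (cmod (matching_poly E z (S - set p) / matching_poly E z S))\<^sup>2)"
    using finite_S assms by (intro member_le_sum finite_paths_in path_in_singleton) auto
  then show ?thesis
    using Im_z by (subst path_norm_sum_green[OF assms, symmetric]) (simp add: green_def)
qed

lemma Im_green_le: "- Im (green E z S v) \<le> cmod (green E z S v)"
  using abs_Im_le_cmod[of "green E z S v"] by linarith

lemma norm_green_le: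
  assumes "v \<in> S"
  shows "Im z * cmod (green E z S v) \<le> 1"
proof (cases "green E z S v = 0")
  case False
  have "Im z * cmod (green E z S v) * cmod (green E z S v) \<le> 1 * cmod (green E z S v)"
    using norm_green_sq_le[OF assms] Im_green_le[of v] by (simp add: power2_eq_square)
  then show ?thesis using False by (subst (asm) mult_le_cancel_right) auto
qed simp

lemma Im_green_nonneg: "v \<in> S \<Longrightarrow> 0 \<le> - Im (green E z S v)"
  using norm_green_sq_le[of v] Im_z by (smt (verit) mult_nonneg_nonneg zero_le_power2)

text \<open>Only the paths starting with \<open>u\<close>, \<open>v\<close> are kept in the norm sum
  at \<open>u\<close>. Factoring out R(S, u) leaves the norm sum at \<open>v\<close> in
  \<open>S - {u}\<close>.\<close>

lemma Im_green_neighbour: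
  assumes "u \<in> S" "v \<in> S" "E u v"
  shows "(cmod (green E z S u))\<^sup>2 * - Im (green E z (S - {u}) v) \<le> - Im (green E z S u)"
proof -
  interpret H: finite_subgraph E "S - {u}" z by (rule remove)
  let ?m = "matching_poly E z"
  have uv: "v \<in> S - {u}" using assms simple by (auto simp: simple_graph_def)
  have S: "S - set (u # q) = S - {u} - set q" for q by auto
  have "(\<Sum>q\<in>paths_in E (S - {u}) v. (cmod (?m (S - set (u # q)) / ?m S))\<^sup>2) \<le>
    (\<Sum>x | x \<in> S - {u} \<and> E u x. \<Sum>q\<in>paths_in E (S - {u}) x. (cmod (?m (S - set (u # q)) / ?m S))\<^sup>2)"
    using finite_S uv assms by (intro member_le_sum) (auto intro: sum_nonneg)
  also have "\<dots> \<le> (\<Sum>p\<in>paths_in E S u. (cmod (?m (S - set p) / ?m S))\<^sup>2)"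
    by (simp add: sum_paths_in[OF finite_S assms(1)])
  finally have *: "(\<Sum>q\<in>paths_in E (S - {u}) v. (cmod (?m (S - set (u # q)) / ?m S))\<^sup>2) \<le> \<dots>" .
  have "(cmod (?m (S - set (u # q)) / ?m S))\<^sup>2
      = (cmod (green E z S u))\<^sup>2 * (cmod (?m (S - {u} - set q) / ?m (S - {u})))\<^sup>2" for q
    unfolding S using nonzero by (simp add: green_def norm_divide power_divide)
  with * have "(cmod (green E z S u))\<^sup>2 * (\<Sum>q\<in>paths_in E (S - {u}) v. (cmod (?m (S - {u} - set q) / ?m (S - {u})))\<^sup>2)
     \<le> (\<Sum>p\<in>paths_in E S u. (cmod (?m (S - set p) / ?m S))\<^sup>2)" by (simp add: sum_distrib_left)
  then have "Im z * ((cmod (green E z S u))\<^sup>2 * (\<Sum>q\<in>paths_in E (S - {u}) v. (cmod (?m (S - {u} - set q) / ?m (S - {u})))\<^sup>2))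
     \<le> Im z * (\<Sum>p\<in>paths_in E S u. (cmod (?m (S - set p) / ?m S))\<^sup>2)" using Im_z by simp
  then show ?thesis
    unfolding path_norm_sum_green[OF assms(1)] H.path_norm_sum_green[OF uv, symmetric]
    by (simp add: mult_ac)
qed

text \<open>By the identity for \<open>W = {w}\<close>, the product R(S, v) (R(S, w) - R(S - v, w))
  is the sum of (\<mu>(S - p) / \<mu>(S))^2 over the paths from \<open>v\<close> to
  \<open>w\<close>. Different \<open>w\<close> use disjoint sets of paths, so all of them together
  cost at most one norm sum.\<close>

lemma sum_green_differences_le:
  assumes "v \<in> S" "F \<subseteq> S - {v}"
  shows "Im z * (\<Sum>w\<in>F. cmod (green E z S v) * cmod (green E z S w - green E z (S - {v}) w))
    \<le> - Im (green E z S v)"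
proof -
  let ?m = "matching_poly E z" and ?P = "paths_in E S v"
  let ?r = "\<lambda>p. (cmod (?m (S - set p) / ?m S))\<^sup>2"
  have fP: "finite ?P" using finite_S by (rule finite_paths_in)
  have "cmod (green E z S v) * cmod (green E z S w - green E z (S - {v}) w)
      \<le> (\<Sum>p\<in>{p\<in>?P. last p = w}. ?r p)" if w: "w \<in> F" for w
  proof -
    have wS: "{w} \<subseteq> S - {v}" using w assms by auto
    have "green E z S v * (green E z S w - green E z (S - {v}) w)
        = green E z S v * green E z S w - ?m (S - {v} - {w}) / ?m S"
      by (simp add: right_diff_distrib green_mult_green)
    also have "\<dots> = (?m (S - {v}) * ?m (S - {w}) - ?m S * ?m (S - {v} - {w})) / (?m S)\<^sup>2"
      using nonzero by (simp add: green_def field_simps power2_eq_square)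
    also have "\<dots> = (\<Sum>p\<in>?P. if set p \<inter> {w} = {last p} then ?m (S - set p) * ?m (S - set p - {w}) / (?m S)\<^sup>2 else 0)"
      by (subst matching_poly_path_identity[OF simple finite_S assms(1) wS])
         (auto simp: sum_divide_distrib intro!: sum.cong)
    also have "\<dots> = (\<Sum>p\<in>?P. if last p = w then (?m (S - set p) / ?m S)\<^sup>2 else 0)"
    proof (rule sum.cong[OF refl])
      fix p assume "p \<in> ?P"
      then have "p \<noteq> []" by (auto simp: paths_in_def paths_from_def)
      then have "(set p \<inter> {w} = {last p}) = (last p = w)" using last_in_set[of p] by auto
      moreover have "S - set p - {w} = S - set p" if "last p = w"
        using that \<open>p \<noteq> []\<close> last_in_set[of p] by auto
      ultimately show "(if set p \<inter> {w} = {last p} then ?m (S - set p) * ?m (S - set p - {w}) / (?m S)\<^sup>2 else 0)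
         = (if last p = w then (?m (S - set p) / ?m S)\<^sup>2 else 0)"
        by (simp add: power_divide power2_eq_square)
    qed
    also have "\<dots> = (\<Sum>p\<in>{p\<in>?P. last p = w}. (?m (S - set p) / ?m S)\<^sup>2)"
      using fP by (rule sum.inter_filter[symmetric])
    finally have "cmod (green E z S v * (green E z S w - green E z (S - {v}) w))
       = cmod (\<Sum>p\<in>{p\<in>?P. last p = w}. (?m (S - set p) / ?m S)\<^sup>2)" by simp
    also have "\<dots> \<le> (\<Sum>p\<in>{p\<in>?P. last p = w}. ?r p)"
      by (rule sum_norm_le) (simp add: norm_power)
    finally show ?thesis by (simp add: norm_mult)
  qed
  then have "(\<Sum>w\<in>F. cmod (green E z S v) * cmod (green E z S w - green E z (S - {v}) w))
     \<le> (\<Sum>w\<in>F. \<Sum>p\<in>{p\<in>?P. last p = w}. ?r p)" by (rule sum_mono)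
  also have "\<dots> = (\<Sum>p\<in>(\<Union>w\<in>F. {p\<in>?P. last p = w}). ?r p)"
    using fP finite_subset[OF assms(2)] finite_S by (intro sum.UNION_disjoint[symmetric]) auto
  also have "\<dots> \<le> (\<Sum>p\<in>?P. ?r p)" using fP by (intro sum_mono2) auto
  finally have "Im z * (\<Sum>w\<in>F. cmod (green E z S v) * cmod (green E z S w - green E z (S - {v}) w))
     \<le> Im z * (\<Sum>p\<in>?P. ?r p)" using Im_z by simp
  then show ?thesis by (simp add: path_norm_sum_green[OF assms(1)])
qed

text \<open>Pulling out R(S, w) turns the second factor into the path weight of
  \<open>S - {w}\<close>, and the paths avoiding \<open>w\<close> are exactly the paths of that set.
  Cauchy--Schwarz then pairs the norm sums of \<open>S\<close> and of
  \<open>S - {w}\<close>.\<close>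

lemma path_pair_sum_le:
  assumes "v \<in> S" "w \<in> S - {v}"
  shows "Im z * (\<Sum>p\<in>{p\<in>paths_in E S v. w \<notin> set p}.
      cmod (matching_poly E z (S - set p) / matching_poly E z S * (matching_poly E z (S - set p - {w}) / matching_poly E z S)))
    \<le> cmod (green E z S w) * sqrt (- Im (green E z S v)) * sqrt (- Im (green E z (S - {w}) v))"
proof -
  interpret H: finite_subgraph E "S - {w}" z by (rule remove)
  let ?m = "matching_poly E z"
  let ?P = "{p\<in>paths_in E S v. w \<notin> set p}"
  let ?a = "\<lambda>p. cmod (?m (S - set p) / ?m S)" and ?b = "\<lambda>p. cmod (?m (S - {w} - set p) / ?m (S - {w}))"
  have P: "?P = paths_in E (S - {w}) v" by (auto simp: paths_in_def)
  have fP: "finite (paths_in E S v)" using finite_S by (rule finite_paths_in)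
  have vw: "v \<in> S - {w}" using assms by auto
  have "?m (S - set p) / ?m S * (?m (S - set p - {w}) / ?m S)
     = green E z S w * (?m (S - set p) / ?m S * (?m (S - {w} - set p) / ?m (S - {w})))" for p
  proof -
    have "S - set p - {w} = S - {w} - set p" by auto
    then show ?thesis using nonzero by (simp add: green_def)
  qed
  then have 1: "(\<Sum>p\<in>?P. cmod (?m (S - set p) / ?m S * (?m (S - set p - {w}) / ?m S)))
     = cmod (green E z S w) * (\<Sum>p\<in>?P. ?a p * ?b p)"
    by (simp only: norm_mult sum_distrib_left)
  have "(\<Sum>p\<in>?P. ?a p * ?b p) \<le> sqrt (\<Sum>p\<in>?P. (?a p)\<^sup>2) * sqrt (\<Sum>p\<in>?P. (?b p)\<^sup>2)"
    using L2_set_mult_ineq[of ?a ?b ?P] by (simp add: L2_set_def)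
  moreover have "sqrt (\<Sum>p\<in>?P. (?a p)\<^sup>2) \<le> sqrt (\<Sum>p\<in>paths_in E S v. (?a p)\<^sup>2)"
    by (intro real_sqrt_le_mono sum_mono2 fP) auto
  moreover have "0 \<le> sqrt (\<Sum>p\<in>?P. (?b p)\<^sup>2)" by (intro real_sqrt_ge_zero sum_nonneg zero_le_power2)
  ultimately have "(\<Sum>p\<in>?P. ?a p * ?b p) \<le>
      sqrt (\<Sum>p\<in>paths_in E S v. (?a p)\<^sup>2) * sqrt (\<Sum>p\<in>?P. (?b p)\<^sup>2)"
    by (meson mult_right_mono order_trans)
  then have "(\<Sum>p\<in>?P. cmod (?m (S - set p) / ?m S * (?m (S - set p - {w}) / ?m S)))
     \<le> cmod (green E z S w) * (sqrt (\<Sum>p\<in>paths_in E S v. (?a p)\<^sup>2) * sqrt (\<Sum>p\<in>?P. (?b p)\<^sup>2))"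
    unfolding 1 by (rule mult_left_mono) simp
  then have "Im z * (\<Sum>p\<in>?P. cmod (?m (S - set p) / ?m S * (?m (S - set p - {w}) / ?m S)))
     \<le> Im z * (cmod (green E z S w) * (sqrt (\<Sum>p\<in>paths_in E S v. (?a p)\<^sup>2) * sqrt (\<Sum>p\<in>?P. (?b p)\<^sup>2)))"
    using Im_z by (intro mult_left_mono) auto
  \<comment> \<open>\<open>Im z\<close> is split evenly, so that each square root receives the
    factor that makes its norm sum an imaginary part.\<close>
  also have "\<dots> = (sqrt (Im z) * sqrt (Im z)) * (cmod (green E z S w) * (sqrt (\<Sum>p\<in>paths_in E S v. (?a p)\<^sup>2) * sqrt (\<Sum>p\<in>?P. (?b p)\<^sup>2)))"
    using Im_z by simp
  also have "\<dots> = cmod (green E z S w) * sqrt (Im z * (\<Sum>p\<in>paths_in E S v. (?a p)\<^sup>2)) * sqrt (Im z * (\<Sum>p\<in>?P. (?b p)\<^sup>2))"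
    unfolding real_sqrt_mult by (simp only: mult_ac)
  also have "\<dots> = cmod (green E z S w) * sqrt (- Im (green E z S v)) * sqrt (- Im (green E z (S - {w}) v))"
    unfolding P path_norm_sum_green[OF assms(1)] H.path_norm_sum_green[OF vw] ..
  finally show ?thesis .
qed

text \<open>The path identity for \<open>W = {u, w}\<close>, divided by \<mu>(S)^2: a path that
  stops at its first visit to \<open>W\<close> avoids the other of the two vertices, so each half of
  the error is a sum bounded in \<open>path_pair_sum_le\<close>.\<close>

lemma green_triple_le:
  assumes "v \<in> S" "u \<in> S - {v}" "w \<in> S - {v}" "u \<noteq> w"
  shows "Im z * cmod (green E z S v * green E z S u * green E z (S - {u}) w)
    \<le> Im z * cmod (green E z S u * green E z (S - {u}) v * green E z (S - {u} - {v}) w)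
     + cmod (green E z S w) * sqrt (- Im (green E z S v)) * sqrt (- Im (green E z (S - {w}) v))
     + cmod (green E z S u) * sqrt (- Im (green E z S v)) * sqrt (- Im (green E z (S - {u}) v))"
proof -
  interpret H: finite_subgraph E "S - {u}" z by (rule remove)
  let ?m = "matching_poly E z" and ?P = "paths_in E S v" and ?W = "{u, w}"
  let ?t = "\<lambda>p x. ?m (S - set p) / ?m S * (?m (S - set p - {x}) / ?m S)"
  have fP: "finite ?P" using finite_S by (rule finite_paths_in)
  have W: "?W \<subseteq> S - {v}" using assms by auto
  have eqs: "S - {u} - {w} = S - ?W" "S - {u} - {v} - {w} = S - {v} - ?W" by auto
  have "green E z S v * green E z S u * green E z (S - {u}) w
     - green E z S u * green E z (S - {u}) v * green E z (S - {u} - {v}) w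
     = (?m (S - {v}) * ?m (S - ?W) - ?m S * ?m (S - {v} - ?W)) / (?m S)\<^sup>2"
    using nonzero H.nonzero unfolding green_def eqs by (simp add: field_simps power2_eq_square)
  also have "\<dots> = (\<Sum>p\<in>?P. (if set p \<inter> ?W = {last p} then ?m (S - set p) * ?m (S - set p - ?W) else 0) / (?m S)\<^sup>2)"
    by (subst matching_poly_path_identity[OF simple finite_S assms(1) W]) (rule sum_divide_distrib)
  finally have "cmod (green E z S v * green E z S u * green E z (S - {u}) w
     - green E z S u * green E z (S - {u}) v * green E z (S - {u} - {v}) w)
     = cmod (\<Sum>p\<in>?P. (if set p \<inter> ?W = {last p} then ?m (S - set p) * ?m (S - set p - ?W) else 0) / (?m S)\<^sup>2)"
    (is "cmod ?L = _") by simp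
  also have "\<dots> \<le> (\<Sum>p\<in>?P. (if w \<notin> set p then cmod (?t p w) else 0) + (if u \<notin> set p then cmod (?t p u) else 0))"
  proof (rule sum_norm_le)
    fix p assume "p \<in> ?P"
    then have "p \<noteq> []" by (auto simp: paths_in_def paths_from_def)
    then have l: "last p \<in> set p" by simp
    show "cmod ((if set p \<inter> ?W = {last p} then ?m (S - set p) * ?m (S - set p - ?W) else 0) / (?m S)\<^sup>2)
      \<le> (if w \<notin> set p then cmod (?t p w) else 0) + (if u \<notin> set p then cmod (?t p u) else 0)"
    proof (cases "set p \<inter> ?W = {last p}")
      case True
      then have "u \<in> set p \<longleftrightarrow> u = last p" "w \<in> set p \<longleftrightarrow> w = last p" "last p = u \<or> last p = w"
        by (metis Int_iff insertCI singletonD singletonI insertE emptyE)+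
      then consider "u \<in> set p" "w \<notin> set p" | "w \<in> set p" "u \<notin> set p" using assms(4) by metis
      then show ?thesis
      proof cases
        case 1
        then have "S - set p - ?W = S - set p - {w}" by auto
        then show ?thesis using 1 True by (simp add: power2_eq_square)
      next
        case 2
        then have "S - set p - ?W = S - set p - {u}" by auto
        then show ?thesis using 2 True by (simp add: power2_eq_square)
      qed
    qed auto
  qed
  also have "\<dots> = (\<Sum>p\<in>{p\<in>?P. w \<notin> set p}. cmod (?t p w)) + (\<Sum>p\<in>{p\<in>?P. u \<notin> set p}. cmod (?t p u))"
    by (simp only: sum.distrib sum.inter_filter[OF fP])
  finally have "Im z * cmod ?L \<le> Im z * (\<Sum>p\<in>{p\<in>?P. w \<notin> set p}. cmod (?t p w)) + Im z * (\<Sum>p\<in>{p\<in>?P. u \<notin> set p}. cmod (?t p u))"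
    using Im_z by (simp add: distrib_left[symmetric])
  moreover have "cmod (green E z S v * green E z S u * green E z (S - {u}) w)
     \<le> cmod ?L + cmod (green E z S u * green E z (S - {u}) v * green E z (S - {u} - {v}) w)"
    by (metis norm_triangle_sub add.commute)
  then have "Im z * cmod (green E z S v * green E z S u * green E z (S - {u}) w)
     \<le> Im z * cmod ?L + Im z * cmod (green E z S u * green E z (S - {u}) v * green E z (S - {u} - {v}) w)"
    using Im_z by (simp add: distrib_left[symmetric])
  ultimately show ?thesis
    using path_pair_sum_le[OF assms(1,3)] path_pair_sum_le[OF assms(1,2)] by linarith
qed

end

section \<open>Lower bounds at every vertex are contradictory\<close>

context finite_subgraph
begin

lemma norm_green_ge: "c \<le> Im z * - Im (green E z S v) \<Longrightarrow> c \<le> Im z * cmod (green E z S v)"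
  using mult_left_mono[OF Im_green_le[of v], of "Im z"] Im_z by linarith

lemma Im_green_mult_le_one: "v \<in> S \<Longrightarrow> Im z * - Im (green E z S v) \<le> 1"
  using mult_left_mono[OF Im_green_le[of v], of "Im z"] Im_z norm_green_le[of v] by linarith

text \<open>With R = R(S, u) and Q = - Im R(S - u, v), \<open>Im_green_neighbour\<close> gives |R|^2
  Q \<le> - Im R \<le> |R|, hence |R| Q \<le> 1. Since R is at least of size c / t, Q is at most t /
  c.\<close>

lemma Im_green_remove_neighbour:
  assumes "u \<in> S" "v \<in> S" "E u v" "0 < c" "c \<le> Im z * - Im (green E z S u)"
  shows "Im z * - Im (green E z (S - {u}) v) \<le> (Im z)\<^sup>2 / c"
proof -
  let ?R = "cmod (green E z S u)" and ?Q = "- Im (green E z (S - {u}) v)"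
  interpret H: finite_subgraph E "S - {u}" z by (rule remove)
  have "v \<in> S - {u}" using assms simple by (auto simp: simple_graph_def)
  then have Q: "0 \<le> ?Q" by (rule H.Im_green_nonneg)
  have R: "c \<le> Im z * ?R" using norm_green_ge[OF assms(5)] .
  then have R0: "0 < ?R" using assms(4) Im_z by (smt (verit) zero_less_mult_pos)
  have "?R * (?R * ?Q) \<le> ?R * 1"
    using Im_green_neighbour[OF assms(1-3)] Im_green_le[of u] by (simp add: power2_eq_square)
  then have "?R * ?Q \<le> 1" using R0 by (subst (asm) mult_le_cancel_left_pos) auto
  moreover have "c * ?Q \<le> Im z * ?R * ?Q" using R Q by (rule mult_right_mono)
  ultimately have "c * ?Q \<le> Im z"
    using mult_left_mono[of "?R * ?Q" 1 "Im z"] Im_z by (simp add: mult.assoc)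
  then have "Im z * (c * ?Q) \<le> Im z * Im z" using Im_z by (intro mult_left_mono) auto
  then show ?thesis using assms(4) by (simp add: field_simps power2_eq_square)
qed

lemma norm_green_remove_neighbour:
  assumes "u \<in> S" "v \<in> S" "E u v" "0 < c" "c \<le> Im z * - Im (green E z S u)"
  shows "Im z * cmod (green E z (S - {u}) v) \<le> Im z / sqrt c"
proof -
  interpret H: finite_subgraph E "S - {u}" z by (rule remove)
  let ?R = "cmod (green E z (S - {u}) v)"
  have "v \<in> S - {u}" using assms simple by (auto simp: simple_graph_def)
  then have "Im z * (Im z * ?R\<^sup>2) \<le> Im z * - Im (green E z (S - {u}) v)"
    using Im_z H.norm_green_sq_le by (intro mult_left_mono) auto
  then have "(Im z * ?R)\<^sup>2 \<le> (Im z)\<^sup>2 / c"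
    using Im_green_remove_neighbour[OF assms] by (simp add: power2_eq_square mult_ac)
  then have "sqrt ((Im z * ?R)\<^sup>2) \<le> sqrt ((Im z)\<^sup>2 / c)" by (rule real_sqrt_le_mono)
  then show ?thesis using Im_z by (simp add: real_sqrt_divide)
qed

text \<open>Smallness of t |R(S - u, v)| passes to the neighbour \<open>w\<close> of
  \<open>v\<close>. In \<open>green_triple_le\<close> times t^2, the lower bounds at
  \<open>u\<close> and \<open>v\<close> extract c^2 on the left. On the right every factor is at
  most 1 except one per term: \<open>a\<close> itself, its square root for the paths avoiding
  \<open>u\<close>, and t / sqrt c for the paths avoiding \<open>w\<close>.\<close>

lemma norm_green_remove_step:
  assumes "u \<in> S" "v \<in> S" "w \<in> S" "u \<noteq> v" "u \<noteq> w" "E w v" "0 < c"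
    and "\<And>x. x \<in> {u, v, w} \<Longrightarrow> c \<le> Im z * - Im (green E z S x)"
    and a: "Im z * cmod (green E z (S - {u}) v) \<le> a" "0 \<le> a"
  shows "c\<^sup>2 * (Im z * cmod (green E z (S - {u}) w)) \<le> a + sqrt a + Im z / sqrt c"
proof -
  let ?t = "Im z" and ?R = "\<lambda>x. cmod (green E z S x)" and ?Q = "\<lambda>x. - Im (green E z S x)"
  have t: "0 < ?t" by (rule Im_z)
  interpret H: finite_subgraph E "S - {u}" z by (rule remove)
  interpret K: finite_subgraph E "S - {u} - {v}" z by (rule H.remove)
  have vw: "v \<noteq> w" using assms simple by (auto simp: simple_graph_def)
  have lt: "?t * ?R x \<le> 1" "0 \<le> ?t * ?R x" if "x \<in> S" for x
    using norm_green_le[OF that] t by auto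
  have Q1: "sqrt (?t * ?Q v) \<le> 1" "0 \<le> sqrt (?t * ?Q v)"
    using Im_green_mult_le_one[OF assms(2)] Im_green_nonneg[OF assms(2)] t
    by (simp_all add: mult_nonneg_nonpos)
  interpret J: finite_subgraph E "S - {w}" z by (rule remove)
  have Q2: "0 \<le> ?t * - Im (green E z (S - {w}) v)" "0 \<le> ?t * - Im (green E z (S - {u}) v)"
    using J.Im_green_nonneg[of v] H.Im_green_nonneg[of v] assms vw t
    by (simp_all add: mult_nonneg_nonpos)
  have main: "?t\<^sup>2 * (?t * cmod (green E z S v * green E z S u * green E z (S - {u}) w))
    \<le> ?t\<^sup>2 * (?t * cmod (green E z S u * green E z (S - {u}) v * green E z (S - {u} - {v}) w)
     + ?R w * sqrt (?Q v) * sqrt (- Im (green E z (S - {w}) v))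
     + ?R u * sqrt (?Q v) * sqrt (- Im (green E z (S - {u}) v)))"
    using assms vw by (intro mult_left_mono green_triple_le) auto
  \<comment> \<open>The factor t^2 is distributed as t, sqrt t, sqrt t over the three factors, which
    makes each of them scale invariant.\<close>
  have sq: "?t\<^sup>2 * (r * sqrt q * sqrt q') = (?t * r) * sqrt (?t * q) * sqrt (?t * q')" for r q q'
  proof -
    have "(?t * r) * sqrt (?t * q) * sqrt (?t * q') = ?t * (sqrt ?t * sqrt ?t) * r * sqrt q * sqrt q'"
      unfolding real_sqrt_mult by (simp only: mult_ac)
    also have "sqrt ?t * sqrt ?t = ?t" using t by simp
    finally show ?thesis by (simp only: power2_eq_square mult_ac)
  qed
  have "c\<^sup>2 * (?t * cmod (green E z (S - {u}) w))
     \<le> (?t * ?R v) * (?t * ?R u) * (?t * cmod (green E z (S - {u}) w))"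
    unfolding power2_eq_square using assms t norm_green_ge
    by (intro mult_right_mono mult_mono) auto
  also have "\<dots> = ?t\<^sup>2 * (?t * cmod (green E z S v * green E z S u * green E z (S - {u}) w))"
    by (simp add: norm_mult power2_eq_square mult_ac)
  also note main
  also have "?t\<^sup>2 * (?t * cmod (green E z S u * green E z (S - {u}) v * green E z (S - {u} - {v}) w)
     + ?R w * sqrt (?Q v) * sqrt (- Im (green E z (S - {w}) v))
     + ?R u * sqrt (?Q v) * sqrt (- Im (green E z (S - {u}) v)))
    = (?t * ?R u) * (?t * cmod (green E z (S - {u}) v)) * (?t * cmod (green E z (S - {u} - {v}) w))
     + (?t * ?R w) * sqrt (?t * ?Q v) * sqrt (?t * - Im (green E z (S - {w}) v))
     + (?t * ?R u) * sqrt (?t * ?Q v) * sqrt (?t * - Im (green E z (S - {u}) v))"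
    unfolding distrib_left sq by (simp add: norm_mult power2_eq_square mult_ac)
  also have "\<dots> \<le> 1 * a * 1 + 1 * 1 * (?t / sqrt c) + 1 * 1 * sqrt a"
  proof (intro add_mono)
    show "(?t * ?R u) * (?t * cmod (green E z (S - {u}) v)) * (?t * cmod (green E z (S - {u} - {v}) w)) \<le> 1 * a * 1"
      using lt assms t vw by (intro mult_mono K.norm_green_le mult_nonneg_nonneg) auto
    \<comment> \<open>Here \<open>w\<close> is the deleted vertex, and the adjacency of
      \<open>v\<close> to it is what gives smallness.\<close>
    have "sqrt (?t * - Im (green E z (S - {w}) v)) \<le> sqrt (?t\<^sup>2 / c)"
      using assms by (intro real_sqrt_le_mono Im_green_remove_neighbour) auto
    also have "\<dots> = ?t / sqrt c" using t by (simp add: real_sqrt_divide)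
    finally have "sqrt (?t * - Im (green E z (S - {w}) v)) \<le> ?t / sqrt c" .
    then show "(?t * ?R w) * sqrt (?t * ?Q v) * sqrt (?t * - Im (green E z (S - {w}) v)) \<le> 1 * 1 * (?t / sqrt c)"
      using lt assms Q1 Q2 t by (intro mult_mono) (auto intro: order_trans)
    have "?t * - Im (green E z (S - {u}) v) \<le> a"
      using mult_left_mono[OF H.Im_green_le[of v], of ?t] t a by linarith
    then have "sqrt (?t * - Im (green E z (S - {u}) v)) \<le> sqrt a" by (rule real_sqrt_le_mono)
    then show "(?t * ?R u) * sqrt (?t * ?Q v) * sqrt (?t * - Im (green E z (S - {u}) v)) \<le> 1 * 1 * sqrt a"
      using lt assms Q1 Q2 t by (intro mult_mono) auto
  qed
  finally show ?thesis by simp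
qed

end

text \<open>The order of the limits matters: for each \<open>t\<close> the finite set has to be large.\<close>

definition iterated_eventually :: "(real \<Rightarrow> 'a set \<Rightarrow> bool) \<Rightarrow> bool" where
  "iterated_eventually P \<longleftrightarrow> (\<forall>\<^sub>F t in at_right 0. \<forall>\<^sub>F S in finite_subsets_at_top UNIV. P t S)"

lemma iterated_eventually_mono: "iterated_eventually P \<Longrightarrow> (\<And>t S. 0 < t \<Longrightarrow> finite S \<Longrightarrow> P t S \<Longrightarrow> Q t S) \<Longrightarrow> iterated_eventually Q"
  unfolding iterated_eventually_def
proof (erule eventually_rev_mp, rule eventually_mono[OF eventually_at_right_less[of 0]], rule impI)
  fix t :: real
  assume "\<And>t S. 0 < t \<Longrightarrow> finite S \<Longrightarrow> P t S \<Longrightarrow> Q t S" "0 < t"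
    "\<forall>\<^sub>F S in finite_subsets_at_top UNIV. P t S"
  then show "\<forall>\<^sub>F S in finite_subsets_at_top UNIV. Q t S"
    unfolding eventually_finite_subsets_at_top by meson
qed

lemma iterated_eventually_conj: "iterated_eventually P \<Longrightarrow> iterated_eventually Q \<Longrightarrow> iterated_eventually (\<lambda>t S. P t S \<and> Q t S)"
  unfolding iterated_eventually_def by (simp add: eventually_conj_iff)

lemma iterated_eventually_ball_finite: "finite F \<Longrightarrow> (\<And>x. x \<in> F \<Longrightarrow> iterated_eventually (P x)) \<Longrightarrow> iterated_eventually (\<lambda>t S. \<forall>x\<in>F. P x t S)"
  unfolding iterated_eventually_def by (simp add: eventually_ball_finite_distrib)

lemma iterated_eventuallyE:
  assumes "iterated_eventually P"
  obtains t S where "0 < t" "finite S" "P t S"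
proof -
  have "\<forall>\<^sub>F t in at_right 0. 0 < t \<and> (\<forall>\<^sub>F S in finite_subsets_at_top UNIV. P t S)"
    using assms eventually_at_right_less[of 0] unfolding iterated_eventually_def by (rule eventually_conj[rotated])
  then obtain t where t: "0 < t" "\<forall>\<^sub>F S in finite_subsets_at_top UNIV. P t S"
    using eventually_happens' trivial_limit_at_right_real by (metis (mono_tags, lifting))
  then show thesis using that unfolding eventually_finite_subsets_at_top by blast
qed

lemma iterated_eventually_superset: "finite F \<Longrightarrow> iterated_eventually (\<lambda>t S. F \<subseteq> S)"
  unfolding iterated_eventually_def eventually_finite_subsets_at_top by (intro always_eventually allI exI[of _ F]) auto

lemma iterated_eventually_less: "0 < e \<Longrightarrow> iterated_eventually (\<lambda>t S. t < e)"
  unfolding iterated_eventually_def by (intro eventually_at_rightI[of 0 e]) auto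

lemma green_lower_bound_contradiction:
  fixes E :: "'a \<Rightarrow> 'a \<Rightarrow> bool"
  assumes E: "simple_graph E" and inf: "infinite (UNIV :: 'a set)" and conn: "connected_graph E"
    and c: "0 < c" and low: "\<And>x. iterated_eventually (\<lambda>t S. c \<le> t * - Im (green E (Complex \<theta> t) S x))"
  shows False
proof -
  fix u :: 'a
  let ?G = "\<lambda>t. green E (Complex \<theta> t)"
  have sub: "finite_subgraph E S (Complex \<theta> t)" if "0 < t" "finite S" for t S
    using that E by unfold_locales auto
  \<comment> \<open>Induction along a walk from \<open>u\<close>. The alternative
    \<open>x = u\<close> is kept because the walk may return to \<open>u\<close>; the next vertex is
    then handled by the estimate for neighbours of \<open>u\<close>.\<close>
  have small: "x = u \<or> (\<forall>e>0. iterated_eventually (\<lambda>t S. t * cmod (?G t (S - {u}) x) \<le> e))" for x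
  proof -
    have "E\<^sup>*\<^sup>* u x" using conn by (simp add: connected_graph_def)
    then show ?thesis
    proof (induction rule: rtranclp_induct)
      case base
      then show ?case by simp
    next
      case (step v w)
      have wv: "E w v" using E step.hyps(2) by (simp add: simple_graph_def)
      show ?case
      proof (cases "w = u")
        case wu: False
        show ?thesis
        proof (intro disjI2 allI impI)
          fix e :: real assume e: "0 < e"
          show "iterated_eventually (\<lambda>t S. t * cmod (?G t (S - {u}) w) \<le> e)"
          proof (cases "v = u")
            case True
            have "iterated_eventually (\<lambda>t S. {u, w} \<subseteq> S \<and> t < e * sqrt c \<and> c \<le> t * - Im (?G t S u))"
              using e c by (intro iterated_eventually_conj iterated_eventually_superset iterated_eventually_less low) auto
            then show ?thesis
            proof (rule iterated_eventually_mono)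
              fix t S assume t: "0 < t" and S: "finite S"
                and *: "{u, w} \<subseteq> S \<and> t < e * sqrt c \<and> c \<le> t * - Im (?G t S u)"
              interpret finite_subgraph E S "Complex \<theta> t" by (rule sub[OF t S])
              have "t * cmod (?G t (S - {u}) w) \<le> t / sqrt c"
                using norm_green_remove_neighbour[of u w c] * step.hyps(2) True c by simp
              also have "\<dots> \<le> e" using * c by (simp add: field_simps)
              finally show "t * cmod (?G t (S - {u}) w) \<le> e" .
            qed
          next
            case vu: False
            \<comment> \<open>Chosen so that the bound d + sqrt d + d of the step lemma is at most 3
              sqrt d \<le> c^2 e; the minimum with 1 ensures d \<le> sqrt d.\<close>
            define d where "d = min 1 ((c\<^sup>2 * e / 3)\<^sup>2)"
            have d: "0 < d" "d \<le> 1" using e c by (auto simp: d_def)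
            have "sqrt d \<le> sqrt ((c\<^sup>2 * e / 3)\<^sup>2)" by (rule real_sqrt_le_mono) (simp add: d_def)
            then have sd: "3 * sqrt d \<le> c\<^sup>2 * e" using e by simp
            have dd: "d \<le> sqrt d" using d by (simp add: real_le_rsqrt power2_eq_square mult_left_le)
            have "iterated_eventually (\<lambda>t S. {u, v, w} \<subseteq> S \<and> t < d * sqrt c \<and> t * cmod (?G t (S - {u}) v) \<le> d
              \<and> (\<forall>x\<in>{u, v, w}. c \<le> t * - Im (?G t S x)))"
              using e c d step.IH vu by (intro iterated_eventually_conj iterated_eventually_superset iterated_eventually_less iterated_eventually_ball_finite low) auto
            then show ?thesis
            proof (rule iterated_eventually_mono)
              fix t S assume t: "0 < t" and S: "finite S"
                and *: "{u, v, w} \<subseteq> S \<and> t < d * sqrt c \<and> t * cmod (?G t (S - {u}) v) \<le> d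
              \<and> (\<forall>x\<in>{u, v, w}. c \<le> t * - Im (?G t S x))"
              interpret finite_subgraph E S "Complex \<theta> t" by (rule sub[OF t S])
              have "c\<^sup>2 * (t * cmod (?G t (S - {u}) w)) \<le> d + sqrt d + t / sqrt c"
                using norm_green_remove_step[of u v w c d] * wu vu wv c d by auto
              also have "t / sqrt c \<le> d" using * c by (simp add: field_simps)
              finally have "c\<^sup>2 * (t * cmod (?G t (S - {u}) w)) \<le> c\<^sup>2 * e" using sd dd by linarith
              then show "t * cmod (?G t (S - {u}) w) \<le> e"
                using c by (subst (asm) mult_le_cancel_left_pos) auto
            qed
          qed
        qed
      qed simp
    qed
  qed
  \<comment> \<open>Each vertex of \<open>F\<close> will contribute at least c * (c / 2) to a sum
    bounded by 1: t |R(S, u)| \<ge> c, and t |R(S, w)| \<ge> c drops to at most c / 2 when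
    \<open>u\<close> is deleted.\<close>
  obtain n :: nat where n: "1 < n * (c * (c / 2))"
    using reals_Archimedean3[of "c * (c / 2)"] c by (meson half_gt_zero mult_pos_pos)
  have "infinite (UNIV - {u})" using inf by simp
  then obtain F where F: "finite F" "card F = n" "F \<subseteq> UNIV - {u}"
    using infinite_arbitrarily_large by blast
  have half: "iterated_eventually (\<lambda>t S. t * cmod (?G t (S - {u}) w) \<le> c / 2)" if "w \<in> F" for w
  proof -
    have "w \<noteq> u" using F(3) that by auto
    then have "\<forall>e>0. iterated_eventually (\<lambda>t S. t * cmod (?G t (S - {u}) w) \<le> e)" using small[of w] by simp
    then show ?thesis using c half_gt_zero by blast
  qed
  have "iterated_eventually (\<lambda>t S. insert u F \<subseteq> S \<and> c \<le> t * - Im (?G t S u) \<and>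
      (\<forall>w\<in>F. t * cmod (?G t (S - {u}) w) \<le> c / 2 \<and> c \<le> t * - Im (?G t S w)))"
    using F by (intro iterated_eventually_conj iterated_eventually_superset iterated_eventually_ball_finite low half) auto
  then obtain t S where t: "0 < t" and S: "finite S" and sup: "insert u F \<subseteq> S"
    and u: "c \<le> t * - Im (?G t S u)"
    and w: "\<And>w. w \<in> F \<Longrightarrow> t * cmod (?G t (S - {u}) w) \<le> c / 2"
       "\<And>w. w \<in> F \<Longrightarrow> c \<le> t * - Im (?G t S w)" by (rule iterated_eventuallyE) auto
  interpret finite_subgraph E S "Complex \<theta> t" by (rule sub[OF t S])
  have "n * (c * (c / 2)) = (\<Sum>w\<in>F. c * (c / 2))" using F by simp
  also have "\<dots> \<le> (\<Sum>w\<in>F. (t * cmod (?G t S u)) * (t * cmod (?G t S w - ?G t (S - {u}) w)))"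
  proof (intro sum_mono mult_mono)
    fix x assume x: "x \<in> F"
    have "c \<le> t * cmod (?G t S x)" using norm_green_ge[of c x] w(2)[OF x] by simp
    also have "\<dots> \<le> t * (cmod (?G t S x - ?G t (S - {u}) x) + cmod (?G t (S - {u}) x))"
      using t norm_triangle_sub[of "?G t S x" "?G t (S - {u}) x"]
      by (intro mult_left_mono) (auto simp: add.commute)
    finally show "c / 2 \<le> t * cmod (?G t S x - ?G t (S - {u}) x)"
      using w(1)[OF x] by (simp add: distrib_left)
  qed (use c t norm_green_ge[of c u] u in auto)
  also have "\<dots> = t * (t * (\<Sum>w\<in>F. cmod (?G t S u) * cmod (?G t S w - ?G t (S - {u}) w)))"
    by (simp add: sum_distrib_left mult_ac)
  also have "\<dots> \<le> t * - Im (?G t S u)"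
    using sum_green_differences_le[of u F] sup F t by (intro mult_left_mono) auto
  also have "\<dots> \<le> 1" using Im_green_mult_le_one[of u] sup by simp
  finally show False using n by simp
qed

section \<open>Adjacency operators of finite graphs\<close>

text \<open>The Riesz functional of the sequence \<open>m\<close>, sending x^i to
  \<open>m i\<close>. It serves both for moment sequences and, with powers of an operator as
  \<open>m\<close>, for polynomials of that operator.\<close>

definition moment_functional :: "(nat \<Rightarrow> real) \<Rightarrow> real poly \<Rightarrow> real" where
  "moment_functional m p = (\<Sum>i\<le>degree p. coeff p i * m i)"

lemma sum_coeff_ge_degree:
  fixes p :: "real poly"
  assumes "degree p \<le> n"
  shows "(\<Sum>i\<le>degree p. coeff p i * (m i :: real)) = (\<Sum>i\<le>n. coeff p i * m i)"
  using assms by (intro sum.mono_neutral_left) (auto simp: coeff_eq_0)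

lemma moment_functional_add:
  "moment_functional m (p + q) = moment_functional m p + moment_functional m q"
proof -
  let ?n = "max (degree p) (degree q)"
  have n: "degree (p + q) \<le> ?n" "degree p \<le> ?n" "degree q \<le> ?n" by (simp_all add: degree_add_le)
  show ?thesis
    unfolding moment_functional_def n[THEN sum_coeff_ge_degree]
    by (simp add: sum.distrib distrib_right)
qed

lemma moment_functional_smult: "moment_functional m (smult a p) = a * moment_functional m p"
proof -
  have "degree (smult a p) \<le> degree p" by (rule degree_smult_le)
  then show ?thesis
    unfolding moment_functional_def
    by (simp add: sum_coeff_ge_degree[of _ "degree p"] sum_distrib_left mult_ac)
qed

lemma moment_functional_0 [simp]: "moment_functional m 0 = 0"
  by (simp add: moment_functional_def)

lemma moment_functional_sum: "moment_functional m (\<Sum>i\<in>I. f i) = (\<Sum>i\<in>I. moment_functional m (f i))"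
  by (induction I rule: infinite_finite_induct) (simp_all add: moment_functional_add)

locale finite_adjacency =
  fixes V :: "'b set" and adj :: "'b \<Rightarrow> 'b \<Rightarrow> bool" and D :: nat
  assumes finite_V: "finite V" and adj_sym: "adj p q \<Longrightarrow> adj q p"
    and adj_degree: "p \<in> V \<Longrightarrow> card {q\<in>V. adj p q} \<le> D"
begin

text \<open>Functions live on the whole type; the values outside \<open>V\<close> are set to 0 and
  are not seen by \<open>ip\<close>.\<close>

definition A :: "('b \<Rightarrow> real) \<Rightarrow> 'b \<Rightarrow> real" where
  "A f p = (if p \<in> V then \<Sum>q | q \<in> V \<and> adj p q. f q else 0)"

definition ip :: "('b \<Rightarrow> real) \<Rightarrow> ('b \<Rightarrow> real) \<Rightarrow> real" where
  "ip f g = (\<Sum>p\<in>V. f p * g p)"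

lemma A_linear:
  "A (\<lambda>x. 0) = (\<lambda>x. 0)"
  "A (\<lambda>x. f x + g x) = (\<lambda>x. A f x + A g x)"
  "A (\<lambda>x. c * f x) = (\<lambda>x. c * A f x)"
  "A (\<lambda>x. \<Sum>i\<in>I. F i x) = (\<lambda>x. \<Sum>i\<in>I. A (F i) x)"
  using sum.swap by (fastforce simp: A_def fun_eq_iff sum.distrib sum_distrib_left)+

lemma A_uminus: "A (\<lambda>x. - f x) = (\<lambda>x. - A f x)"
  using A_linear(3)[of "-1" f] by simp

lemma ip_linear:
  "ip (\<lambda>x. f x + g x) h = ip f h + ip g h" "ip (\<lambda>x. c * f x) h = c * ip f h"
  "ip h (\<lambda>x. f x + g x) = ip h f + ip h g" "ip h (\<lambda>x. c * f x) = c * ip h f"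
  by (simp_all add: ip_def algebra_simps sum.distrib sum_distrib_left)

lemma ip_nonneg: "0 \<le> ip f f"
  by (simp add: ip_def sum_nonneg)

lemma ip_Cauchy_Schwarz: "\<bar>ip f g\<bar> \<le> sqrt (ip f f) * sqrt (ip g g)"
proof -
  have "(ip f g)\<^sup>2 \<le> ip f f * ip g g"
    using Cauchy_Schwarz_ineq_sum[of f g V] by (simp add: ip_def power2_eq_square)
  then have "sqrt ((ip f g)\<^sup>2) \<le> sqrt (ip f f * ip g g)" by (rule real_sqrt_le_mono)
  then show ?thesis by (simp add: real_sqrt_mult)
qed

lemma ip_A: "ip (A f) g = ip f (A g)"
proof -
  have "ip (A f) g = (\<Sum>p\<in>V. \<Sum>q\<in>V. if adj p q then f q * g p else 0)"
    using finite_V by (simp add: ip_def A_def sum_distrib_right sum.inter_filter if_distrib[where f = "\<lambda>x. x * _"] cong: if_cong)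
  also have "\<dots> = (\<Sum>q\<in>V. \<Sum>p\<in>V. if adj p q then f q * g p else 0)" by (rule sum.swap)
  also have "\<dots> = (\<Sum>q\<in>V. \<Sum>p\<in>V. if adj q p then f q * g p else 0)"
    using adj_sym by (intro sum.cong) auto
  also have "\<dots> = ip f (A g)"
    using finite_V by (simp add: ip_def A_def sum_distrib_left sum.inter_filter if_distrib[where f = "\<lambda>x. _ * x"] cong: if_cong)
  finally show ?thesis .
qed

text \<open>The operator norm is at most D: Cauchy--Schwarz over the neighbours of each vertex costs
  one factor D, and counting how often each (f q)^2 occurs costs the other.\<close>

lemma ip_A_bound: "ip (A f) (A f) \<le> (real D)\<^sup>2 * ip f f"
proof -
  have "ip (A f) (A f) = (\<Sum>p\<in>V. (\<Sum>q | q \<in> V \<and> adj p q. f q)\<^sup>2)"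
    by (simp add: ip_def A_def power2_eq_square)
  also have "\<dots> \<le> (\<Sum>p\<in>V. real D * (\<Sum>q | q \<in> V \<and> adj p q. (f q)\<^sup>2))"
  proof (rule sum_mono)
    fix p assume p: "p \<in> V"
    have "(\<Sum>q | q \<in> V \<and> adj p q. 1 * f q)\<^sup>2
        \<le> (\<Sum>q | q \<in> V \<and> adj p q. 1\<^sup>2) * (\<Sum>q | q \<in> V \<and> adj p q. (f q)\<^sup>2)"
      by (rule Cauchy_Schwarz_ineq_sum)
    also have "\<dots> \<le> real D * (\<Sum>q | q \<in> V \<and> adj p q. (f q)\<^sup>2)"
      using adj_degree[OF p] by (intro mult_right_mono sum_nonneg) auto
    finally show "(\<Sum>q | q \<in> V \<and> adj p q. f q)\<^sup>2 \<le> real D * (\<Sum>q | q \<in> V \<and> adj p q. (f q)\<^sup>2)"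
      by simp
  qed
  also have "\<dots> = real D * (\<Sum>p\<in>V. \<Sum>q\<in>V. if adj p q then (f q)\<^sup>2 else 0)"
    using finite_V by (simp add: sum_distrib_left sum.inter_filter)
  also have "(\<Sum>p\<in>V. \<Sum>q\<in>V. if adj p q then (f q)\<^sup>2 else 0)
     = (\<Sum>q\<in>V. \<Sum>p\<in>V. if adj q p then (f q)\<^sup>2 else 0)"
    using adj_sym by (subst sum.swap) (intro sum.cong, auto)
  also have "\<dots> = (\<Sum>q\<in>V. real (card {p\<in>V. adj q p}) * (f q)\<^sup>2)"
    using finite_V by (simp add: sum.inter_filter[symmetric])
  also have "\<dots> \<le> (\<Sum>q\<in>V. real D * (f q)\<^sup>2)"
    using adj_degree by (intro sum_mono mult_right_mono) auto
  also have "\<dots> = real D * ip f f" by (simp add: ip_def sum_distrib_left power2_eq_square)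
  finally show ?thesis by (simp add: power2_eq_square mult_left_mono mult.assoc)
qed

text \<open>This is p(A) f, evaluated pointwise.\<close>

definition opoly :: "real poly \<Rightarrow> ('b \<Rightarrow> real) \<Rightarrow> 'b \<Rightarrow> real" where
  "opoly p f x = moment_functional (\<lambda>i. (A ^^ i) f x) p"

lemma opoly_0 [simp]: "opoly 0 f = (\<lambda>x. 0)"
  by (simp add: opoly_def moment_functional_def fun_eq_iff)

lemma opoly_add: "opoly (p + q) f = (\<lambda>x. opoly p f x + opoly q f x)"
  by (simp add: opoly_def moment_functional_add fun_eq_iff)

lemma opoly_smult: "opoly (smult c p) f = (\<lambda>x. c * opoly p f x)"
  by (simp add: opoly_def moment_functional_smult fun_eq_iff)

lemma opoly_pCons: "opoly (pCons a p) f = (\<lambda>x. a * f x + A (opoly p f) x)"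
proof
  fix x
  have "opoly (pCons a p) f x = (\<Sum>i\<le>Suc (degree p). coeff (pCons a p) i * (A ^^ i) f x)"
    unfolding opoly_def moment_functional_def
    by (rule sum_coeff_ge_degree) (rule degree_pCons_le)
  also have "\<dots> = a * f x + (\<Sum>i\<le>degree p. coeff p i * A ((A ^^ i) f) x)"
    unfolding sum.atMost_Suc_shift by simp
  also have "(\<Sum>i\<le>degree p. coeff p i * A ((A ^^ i) f) x) = A (opoly p f) x"
    by (simp add: opoly_def[abs_def] moment_functional_def A_linear)
  finally show "opoly (pCons a p) f x = a * f x + A (opoly p f) x" .
qed

lemma opoly_const: "opoly [:a:] f = (\<lambda>x. a * f x)"
  by (simp add: opoly_pCons A_linear)

lemma opoly_1 [simp]: "opoly 1 f = f"
  by (simp add: one_pCons opoly_const)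

lemma opoly_linear:
  "opoly p (\<lambda>x. f x + g x) = (\<lambda>x. opoly p f x + opoly p g x)"
  "opoly p (\<lambda>x. c * f x) = (\<lambda>x. c * opoly p f x)"
  by (induction p) (simp_all add: opoly_pCons A_linear algebra_simps)

lemma opoly_mult: "opoly (p * q) f = opoly p (opoly q f)"
  by (induction p) (simp_all add: opoly_pCons opoly_add opoly_smult)

lemma ip_opoly: "ip (opoly p f) g = ip f (opoly p g)"
proof (induction p arbitrary: f g)
  case 0
  then show ?case by (simp add: ip_def)
next
  case (pCons a p)
  have "ip (A (opoly p f)) g = ip f (opoly p (A g))" by (simp add: ip_A pCons.IH)
  also have "opoly p (A g) = A (opoly p g)"
    using opoly_mult[of p "[:0, 1:]" g] opoly_mult[of "[:0, 1:]" p g]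
    by (simp add: opoly_pCons A_linear)
  finally show ?case by (simp add: opoly_pCons ip_linear)
qed

lemma ip_opoly_square: "ip (opoly (r * (s * s)) f) f = ip (opoly r (opoly s f)) (opoly s f)"
proof -
  have "opoly (r * (s * s)) f = opoly s (opoly r (opoly s f))"
    by (metis mult.commute mult.assoc opoly_mult)
  then show ?thesis by (simp add: ip_opoly)
qed

text \<open>The product (D - x)(D + x) is positive on A by \<open>ip_A_bound\<close>. For p either
  factor, 2D = (D - x) + (D + x) gives 2D p = p^2 + (D - x)(D + x), so p is positive too. All higher
  powers split into one of these or 1 times a square, by the parities of \<open>k\<close> and
  \<open>l\<close>.\<close>

lemma ip_opoly_nonneg:
  assumes D: "0 < D"
  shows "0 \<le> ip (opoly ([:real D, -1:] ^ k * [:real D, 1:] ^ l) f) f"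
proof -
  let ?P = "[:real D, -1:]" and ?Q = "[:real D, 1:]"
  have PQ: "0 \<le> ip (opoly (?P * ?Q) g) g" for g
  proof -
    have "opoly (?P * ?Q) g = (\<lambda>x. (real D)\<^sup>2 * g x + (-1) * A (A g) x)"
      by (simp add: opoly_pCons A_linear A_uminus power2_eq_square)
    then have "ip (opoly (?P * ?Q) g) g = (real D)\<^sup>2 * ip g g - ip (A g) (A g)"
      by (simp only: ip_linear ip_A)
    then show ?thesis using ip_A_bound[of g] by simp
  qed
  have sq: "0 \<le> ip (opoly (s * s) g) g" for s g
    using ip_opoly_square[of 1 s g] ip_nonneg by simp
  have PQ2: "[:2 * real D:] = ?P + ?Q" by simp
  have half: "0 \<le> ip (opoly p g) g" if "p \<in> {?P, ?Q}" for p g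
  proof -
    have "smult (2 * real D) p = [:2 * real D:] * p" by simp
    also have "\<dots> = ?P * p + ?Q * p" unfolding PQ2 by (rule distrib_right)
    also have "\<dots> = p * p + ?P * ?Q"
      using that by (elim insertE emptyE) (simp_all only: mult.commute[of ?Q ?P] add.commute)
    finally have eq: "smult (2 * real D) p = p * p + ?P * ?Q" .
    have "2 * real D * ip (opoly p g) g = ip (opoly (smult (2 * real D) p) g) g"
      by (simp only: opoly_smult ip_linear)
    also have "\<dots> = ip (opoly (p * p) g) g + ip (opoly (?P * ?Q) g) g"
      by (simp only: eq opoly_add ip_linear)
    finally have "0 \<le> (2 * real D) * ip (opoly p g) g" using sq PQ by simp
    then show ?thesis using D by (simp add: zero_le_mult_iff)
  qed
  have fac: "p ^ n = p ^ (n mod 2) * (p ^ (n div 2) * p ^ (n div 2))" for p :: "real poly" and n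
  proof -
    have "n = n mod 2 + (n div 2 + n div 2)" by presburger
    then show ?thesis by (metis power_add)
  qed
  define s where "s = ?P ^ (k div 2) * ?Q ^ (l div 2)"
  define r where "r = ?P ^ (k mod 2) * ?Q ^ (l mod 2)"
  have "?P ^ k * ?Q ^ l = r * (s * s)"
    by (subst fac[of ?P], subst fac[of ?Q]) (simp only: r_def s_def mult_ac)
  moreover have "r \<in> {1, ?P, ?Q, ?P * ?Q}"
    unfolding r_def by (cases "even k"; cases "even l") (simp_all add: even_iff_mod_2_eq_zero odd_iff_mod_2_eq_one)
  then have "0 \<le> ip (opoly r g) g" for g using half PQ ip_nonneg by auto
  ultimately show ?thesis by (simp only: ip_opoly_square)
qed

text \<open>The error e = q(A) f - h satisfies w(A) e = (w q - 1)(A) f. Since w(A) = (A -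
  \<theta>)^2 + t^2 is at least t^2, the norm of e is controlled by a polynomial quantity, which
  moments can evaluate.\<close>

lemma resolvent_approx:
  fixes \<theta> t :: real
  defines "w \<equiv> [:\<theta>\<^sup>2 + t\<^sup>2, - 2 * \<theta>, 1:]"
  assumes t: "0 < t" and h: "opoly w h = f"
  shows "t\<^sup>2 * \<bar>ip (opoly q f) f - ip h f\<bar> \<le>
    sqrt (ip (opoly ((w * q - 1) * (w * q - 1)) f) f) * sqrt (ip f f)"
proof -
  define e where "e = (\<lambda>x. opoly q f x + (-1) * h x)"
  define d where "d = opoly (w * q - 1) f"
  let ?n = "\<lambda>f. sqrt (ip f f)"
  have "w * q - 1 = w * q + smult (-1) 1"
    by (simp only: smult_minus_left smult_1_left diff_conv_add_uminus)
  then have d: "opoly w e = d"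
    unfolding e_def d_def by (simp only: opoly_linear opoly_add opoly_smult opoly_mult h opoly_1)
  have w: "w = [:-\<theta>, 1:] * [:-\<theta>, 1:] + smult (t\<^sup>2) 1" by (simp add: w_def power2_eq_square one_pCons)
  let ?g = "opoly [:-\<theta>, 1:] e"
  have "ip d e = ip ?g ?g + t\<^sup>2 * ip e e"
    unfolding d[symmetric] w opoly_add opoly_smult ip_linear opoly_1 opoly_mult ip_opoly[of "[:-\<theta>, 1:]" "?g"] ..
  then have "t\<^sup>2 * ip e e \<le> ?n d * ?n e" using ip_nonneg[of ?g] ip_Cauchy_Schwarz[of d e] by simp
  moreover have "ip e e = ?n e * ?n e" using ip_nonneg by simp
  ultimately have *: "(t\<^sup>2 * ?n e) * ?n e \<le> ?n d * ?n e" by (metis mult.assoc)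
  have e_le: "t\<^sup>2 * ?n e \<le> ?n d"
  proof (cases "?n e = 0")
    case False
    then have "0 < ?n e" using ip_nonneg[of e] by simp
    with * show ?thesis by (rule mult_right_le_imp_le)
  qed (use ip_nonneg in simp)
  have "ip (opoly q f) f - ip h f = ip e f" unfolding e_def ip_linear by simp
  then have "t\<^sup>2 * \<bar>ip (opoly q f) f - ip h f\<bar> \<le> t\<^sup>2 * (?n e * ?n f)"
    using ip_Cauchy_Schwarz[of e f] by (simp add: mult_left_mono)
  also have "\<dots> = (t\<^sup>2 * ?n e) * ?n f" by simp
  also have "\<dots> \<le> ?n d * ?n f" using e_le ip_nonneg by (intro mult_right_mono) auto
  also have "ip d d = ip (opoly ((w * q - 1) * (w * q - 1)) f) f"
    using ip_opoly_square[of 1 "w * q - 1" f] by (simp add: d_def)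
  finally show ?thesis .
qed

end

section \<open>Finite path trees\<close>

lemma snoc_in_paths_from:
  assumes "p \<noteq> []"
  shows "p @ [x] \<in> paths_from E u \<longleftrightarrow> p \<in> paths_from E u \<and> x \<notin> set p \<and> E (last p) x"
proof -
  have "(\<forall>i. Suc i < length (p @ [x]) \<longrightarrow> E ((p @ [x]) ! i) ((p @ [x]) ! Suc i)) \<longleftrightarrow>
      (\<forall>i. Suc i < length p \<longrightarrow> E (p ! i) (p ! Suc i)) \<and> E (last p) x" (is "?L \<longleftrightarrow> ?R")
  proof
    assume L: ?L
    have "E (p ! i) (p ! Suc i)" if "Suc i < length p" for i
      using L[rule_format, of i] that by (simp add: nth_append)
    moreover have "E (last p) x"
      using L[rule_format, of "length p - 1"] assms by (simp add: nth_append last_conv_nth)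
    ultimately show ?R by blast
  next
    assume R: ?R
    show ?L
    proof (intro allI impI)
      fix i assume "Suc i < length (p @ [x])"
      then consider "Suc i < length p" | "i = length p - 1" "Suc i = length p" by fastforce
      then show "E ((p @ [x]) ! i) ((p @ [x]) ! Suc i)"
        using R assms by cases (auto simp: nth_append last_conv_nth)
    qed
  qed
  then show ?thesis using assms by (auto simp: paths_from_def)
qed

lemma path_tree_adj_sym: "path_tree_adj p q \<Longrightarrow> path_tree_adj q p"
  by (auto simp: path_tree_adj_def)

lemma path_tree_adj_length: "path_tree_adj p q \<Longrightarrow> length q \<le> Suc (length p)"
  by (auto simp: path_tree_adj_def)

lemma finite_short_paths:
  assumes "degree_bounded E D"
  shows "finite {p \<in> paths_from E u. length p \<le> n}"
proof (induction n)
  case 0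
  have "{p \<in> paths_from E u. length p \<le> 0} = {}" by (auto simp: paths_from_def)
  then show ?case by (metis finite.emptyI)
next
  case (Suc n)
  let ?B = "{p \<in> paths_from E u. length p \<le> n}"
  have "{p \<in> paths_from E u. length p \<le> Suc n} \<subseteq>
    insert [u] (\<Union>p\<in>?B. (\<lambda>y. p @ [y]) ` {y. E (last p) y})"
  proof
    fix p assume p: "p \<in> {p \<in> paths_from E u. length p \<le> Suc n}"
    then obtain q x where q: "p = q @ [x]" by (cases p rule: rev_cases) (auto simp: paths_from_def)
    show "p \<in> insert [u] (\<Union>p\<in>?B. (\<lambda>y. p @ [y]) ` {y. E (last p) y})"
    proof (cases "q = []")
      case True
      then show ?thesis using p q by (auto simp: paths_from_def)
    next
      case False
      then have "q \<in> ?B" "E (last q) x" using p q by (auto simp: snoc_in_paths_from)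
      then show ?thesis using q by blast
    qed
  qed
  moreover have "finite (insert [u] (\<Union>p\<in>?B. (\<lambda>y. p @ [y]) ` {y. E (last p) y}))"
    using Suc assms by (auto simp: degree_bounded_def)
  ultimately show ?case by (rule finite_subset)
qed

locale finite_path_tree =
  fixes E :: "'a \<Rightarrow> 'a \<Rightarrow> bool" and S :: "'a set" and D :: nat and u :: 'a
  assumes simple: "simple_graph E" and finite_S: "finite S" and u: "u \<in> S"
    and degree: "degree_bounded E D"
begin

abbreviation "V \<equiv> paths_in E S u"

lemma V_nonempty: "p \<in> V \<Longrightarrow> p \<noteq> []"
  by (simp add: paths_in_def paths_from_def)

lemma V_snoc: "p \<noteq> [] \<Longrightarrow> p @ [x] \<in> V \<longleftrightarrow> p \<in> V \<and> x \<in> S - set p \<and> E (last p) x"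
  by (auto simp: paths_in_def snoc_in_paths_from)

lemma root_in_V: "[u] \<in> V"
  using u by (simp add: paths_in_def Cons_in_paths_from)

text \<open>A tree neighbour of \<open>p\<close> is determined by its last vertex, a graph neighbour
  of \<open>last p\<close>: children end off \<open>p\<close>, the parent ends on
  \<open>p\<close>.\<close>

lemma card_neighbours_le:
  assumes p: "p \<in> V"
  shows "card {q\<in>V. path_tree_adj p q} \<le> D"
proof -
  let ?N = "{q\<in>V. path_tree_adj p q}"
  have cases: "(\<exists>x. q = p @ [x] \<and> x \<notin> set p \<and> E (last p) x) \<or>
      (\<exists>x. p = q @ [x] \<and> last q \<in> set p \<and> E (last p) (last q))" if "q \<in> ?N" for q
    using that p V_nonempty[of q] V_nonempty[of p] simple
    by (auto simp: path_tree_adj_def V_snoc simple_graph_def)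
  have "inj_on last ?N"
  proof (rule inj_onI)
    fix q q' assume "q \<in> ?N" "q' \<in> ?N" "last q = last q'"
    then show "q = q'" using cases[of q] cases[of q'] by auto
  qed
  then have "card ?N = card (last ` ?N)" by (simp add: card_image)
  also have "last ` ?N \<subseteq> {y. E (last p) y}" using cases by fastforce
  then have "card (last ` ?N) \<le> card {y. E (last p) y}"
    using degree by (intro card_mono) (auto simp: degree_bounded_def)
  also have "\<dots> \<le> D" using degree by (simp add: degree_bounded_def)
  finally show ?thesis .
qed

sublocale finite_adjacency V path_tree_adj D
  using finite_paths_in[OF finite_S] path_tree_adj_sym card_neighbours_le by unfold_locales

definition root :: "'a list \<Rightarrow> real" where "root p = (if p = [u] then 1 else 0)"

lemma ip_root: "ip f root = f [u]" "ip root root = 1"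
  using root_in_V finite_V by (simp_all add: ip_def root_def if_distrib sum.delta cong: if_cong)

text \<open>The root is singled out because its \<open>butlast\<close> is the empty list, which is
  not a path.\<close>

lemma neighbours_eq:
  assumes p: "p \<in> V"
  shows "{q\<in>V. path_tree_adj p q} =
    (\<lambda>y. p @ [y]) ` {y. y \<in> S - set p \<and> E (last p) y} \<union> (if p = [u] then {} else {butlast p})"
proof (intro equalityI subsetI)
  fix q assume "q \<in> {q\<in>V. path_tree_adj p q}"
  then consider x where "q = p @ [x]" "q \<in> V" | x where "p = q @ [x]" "q \<in> V"
    by (auto simp: path_tree_adj_def)
  then show "q \<in> (\<lambda>y. p @ [y]) ` {y. y \<in> S - set p \<and> E (last p) y} \<union> (if p = [u] then {} else {butlast p})"
  proof cases
    case 1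
    then have "x \<in> {y. y \<in> S - set p \<and> E (last p) y}" using V_snoc[OF V_nonempty[OF p]] by auto
    then show ?thesis using 1 by blast
  next
    case 2
    then show ?thesis using V_nonempty[of q] by auto
  qed
next
  fix q assume "q \<in> (\<lambda>y. p @ [y]) ` {y. y \<in> S - set p \<and> E (last p) y} \<union> (if p = [u] then {} else {butlast p})"
  then consider y where "q = p @ [y]" "y \<in> S - set p" "E (last p) y" | "p \<noteq> [u]" "q = butlast p"
    by (auto split: if_splits)
  then show "q \<in> {q\<in>V. path_tree_adj p q}"
  proof cases
    case 1
    then show ?thesis using p V_nonempty[OF p] by (auto simp: V_snoc path_tree_adj_def)
  next
    case 2
    obtain r x where r: "p = r @ [x]" using V_nonempty[OF p] by (cases p rule: rev_cases) auto
    then have "r \<noteq> []" using 2 p by (auto simp: paths_in_def paths_from_def)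
    then show ?thesis using p r 2 by (auto simp: V_snoc path_tree_adj_def)
  qed
qed

text \<open>Godsil's observation: \<open>matching_poly_remove\<close> at the last vertex of
  \<open>p\<close>, inside \<open>S\<close> minus the rest of \<open>p\<close>, is the resolvent
  equation of the path tree. The sets S - p - y belong to the children, and the set on the left to
  the parent.\<close>

lemma path_green_equation:
  fixes z :: complex
  defines "g \<equiv> \<lambda>p. matching_poly E z (S - set p) / matching_poly E z S"
  assumes z: "Im z > 0" and p: "p \<in> V"
  shows "z * g p - (\<Sum>q | q \<in> V \<and> path_tree_adj p q. g q) = of_real (root p)"
proof -
  let ?m = "matching_poly E z" and ?C = "{y. y \<in> S - set p \<and> E (last p) y}"
  have nz: "?m S \<noteq> 0" using matching_poly_nonzero[OF simple finite_S z] .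
  obtain r x where r: "p = r @ [x]" using V_nonempty[OF p] by (cases p rule: rev_cases) auto
  have x: "x \<in> S - set r" using p by (auto simp: r paths_in_def paths_from_def)
  have rem: "S - set r - {x} = S - set p" by (auto simp: r)
  have "?m (S - set r) = z * ?m (S - set p) - (\<Sum>y\<in>?C. ?m (S - set p - {y}))"
    using matching_poly_remove[OF simple _ x, of z] finite_S unfolding rem by (simp add: r)
  moreover have "S - set (p @ [y]) = S - set p - {y}" for y by auto
  then have "(\<Sum>q\<in>(\<lambda>y. p @ [y]) ` ?C. g q) = (\<Sum>y\<in>?C. ?m (S - set p - {y})) / ?m S"
    by (subst sum.reindex) (auto simp: inj_on_def g_def sum_divide_distrib)
  moreover have "(\<Sum>q | q \<in> V \<and> path_tree_adj p q. g q) =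
     (\<Sum>q\<in>(\<lambda>y. p @ [y]) ` ?C. g q) + (if p = [u] then 0 else g r)"
    unfolding neighbours_eq[OF p] using finite_S
    by (subst sum.union_disjoint) (auto simp: r)
  \<comment> \<open>At the root the missing parent would contribute this 1, which becomes the
    right-hand side.\<close>
  moreover have "g r = 1" if "p = [u]" using that nz by (simp add: r g_def)
  moreover have "g r = ?m (S - set r) / ?m S" by (simp add: g_def)
  ultimately show ?thesis
    by (auto simp: root_def g_def diff_divide_distrib)
qed

text \<open>The witness h = - Im g / t is the real function ((A - \<theta>)^2 + t^2)^(-1) applied to
  \<open>root\<close>, because - Im (1 / (z - x)) = t / ((x - \<theta>)^2 + t^2). It keeps the
  operator calculus over the reals.\<close>

lemma green_resolvent:
  fixes \<theta> t :: real
  assumes t: "0 < t"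
  obtains h where "opoly [:\<theta>\<^sup>2 + t\<^sup>2, - 2 * \<theta>, 1:] h = root"
    and "ip h root = - Im (green E (Complex \<theta> t) S u) / t"
proof -
  let ?z = "Complex \<theta> t"
  define g where "g p = matching_poly E ?z (S - set p) / matching_poly E ?z S" for p
  define a where "a p = (if p \<in> V then Re (g p) else 0)" for p
  define h where "h p = (if p \<in> V then - Im (g p) / t else 0)" for p
  have Aa: "A a p = (\<Sum>q | q \<in> V \<and> path_tree_adj p q. Re (g q))" if "p \<in> V" for p
    using that unfolding A_def a_def by (auto intro: sum.cong)
  have Ah: "A h p = - (\<Sum>q | q \<in> V \<and> path_tree_adj p q. Im (g q)) / t" if "p \<in> V" for p
    using that unfolding A_def h_def by (auto simp: sum_divide_distrib sum_negf[symmetric] intro: sum.cong)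
  \<comment> \<open>The imaginary part of the resolvent equation; the real part follows, and
    eliminating \<open>a\<close> gives the quadratic equation for \<open>h\<close>.\<close>
  have a: "a p = \<theta> * h p - A h p" for p
  proof (cases "p \<in> V")
    case True
    then have "Im (?z * g p - (\<Sum>q | q \<in> V \<and> path_tree_adj p q. g q)) = Im (of_real (root p))"
      using path_green_equation[of ?z p] t unfolding g_def by simp
    then show ?thesis using t True by (simp add: Ah a_def h_def field_simps)
  qed (simp add: a_def h_def A_def)
  have r: "root p = \<theta> * a p + t\<^sup>2 * h p - A a p" for p
  proof (cases "p \<in> V")
    case True
    then have "Re (?z * g p - (\<Sum>q | q \<in> V \<and> path_tree_adj p q. g q)) = Re (of_real (root p))"
      using path_green_equation[of ?z p] t unfolding g_def by simp
    then show ?thesis using t True by (simp add: Aa a_def h_def power2_eq_square)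
  next
    case False
    then show ?thesis using root_in_V by (auto simp: a_def h_def A_def root_def)
  qed
  have "A a = A (\<lambda>p. \<theta> * h p + (-1) * A h p)" using a by (intro arg_cong[of _ _ A]) auto
  also have "\<dots> = (\<lambda>p. \<theta> * A h p + (-1) * A (A h) p)" by (simp only: A_linear)
  finally have Aa': "A a p = \<theta> * A h p - A (A h) p" for p by simp
  have "root p = \<theta> * (\<theta> * h p - A h p) + t\<^sup>2 * h p - (\<theta> * A h p - A (A h) p)" for p
    by (simp only: r[of p] Aa'[of p] a[of p])
  moreover have "opoly [:\<theta>\<^sup>2 + t\<^sup>2, - 2 * \<theta>, 1:] h p = (\<theta>\<^sup>2 + t\<^sup>2) * h p + (- 2 * \<theta> * A h p + A (A h) p)" for p
    by (simp only: opoly_pCons A_linear opoly_0 mult_1 add_0_right)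
  ultimately have "opoly [:\<theta>\<^sup>2 + t\<^sup>2, - 2 * \<theta>, 1:] h p = root p" for p
    by (simp only: power2_eq_square) (simp add: algebra_simps)
  moreover have "ip h root = - Im (green E ?z S u) / t"
    using root_in_V by (simp add: ip_root h_def g_def green_def)
  ultimately show thesis using that[of h] by (simp add: fun_eq_iff)
qed

text \<open>Walks of length \<open>k\<close> only see paths with at most \<open>k + 1\<close> vertices.\<close>

lemma power_A_root:
  assumes N: "\<And>p. p \<in> paths_from E u \<Longrightarrow> length p \<le> Suc N \<Longrightarrow> set p \<subseteq> S"
  defines "W \<equiv> \<lambda>k p. {w. length w = Suc k \<and> set w \<subseteq> paths_from E u \<and> w ! 0 = [u] \<and> w ! k = p \<and>
      (\<forall>i<k. path_tree_adj (w ! i) (w ! Suc i))}"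
  assumes "k \<le> N"
  shows "finite (W k p) \<and> (p \<in> V \<longrightarrow> (A ^^ k) root p = real (card (W k p)))"
  using \<open>k \<le> N\<close>
\<comment> \<open>Finiteness is carried along because the cardinality of the disjoint union over the
  last step depends on it.\<close>
proof (induction k arbitrary: p)
  case 0
  have "W 0 p = (if p = [u] then {[[u]]} else {})"
    using root_in_V by (auto simp: W_def paths_in_def length_Suc_conv)
  then show ?case by (simp add: root_def)
next
  case (Suc k)
  have len: "length (w ! i) \<le> Suc i" if "w \<in> W k q" "i \<le> k" for w q i
    using that(2)
  proof (induction i)
    case 0
    then show ?case using that by (simp add: W_def)
  next
    case (Suc i)
    then have "path_tree_adj (w ! i) (w ! Suc i)" using that(1) by (auto simp: W_def)
    then show ?case using Suc path_tree_adj_length[of "w ! i" "w ! Suc i"] by simp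
  qed
  have in_V: "q \<in> V" if "w \<in> W k q" for w q
  proof -
    have "w ! k = q" "w ! k \<in> set w" "set w \<subseteq> paths_from E u" using that by (auto simp: W_def)
    moreover have "length (w ! k) \<le> Suc N" using len[OF that, of k] Suc.prems by simp
    ultimately show ?thesis using N by (auto simp: paths_in_def)
  qed
  have fin: "finite (W k q)" for q using Suc by simp
  have ext: "W (Suc k) p \<subseteq> (\<Union>q\<in>{q\<in>V. path_tree_adj p q}. (\<lambda>w. w @ [p]) ` W k q)"
  proof
    fix w assume w: "w \<in> W (Suc k) p"
    then obtain v x where v: "w = v @ [x]" by (cases w rule: rev_cases) (auto simp: W_def)
    have "x = p" using w by (auto simp: v W_def nth_append)
    moreover have "v \<in> W k (v ! k)" using w by (auto simp: v W_def nth_append split: if_splits)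
    moreover have "path_tree_adj (v ! k) p"
      using w \<open>x = p\<close> by (fastforce simp: v W_def nth_append)
    ultimately show "w \<in> (\<Union>q\<in>{q\<in>V. path_tree_adj p q}. (\<lambda>w. w @ [p]) ` W k q)"
      using in_V path_tree_adj_sym v by blast
  qed
  have fin_rhs: "finite (\<Union>q\<in>{q\<in>V. path_tree_adj p q}. (\<lambda>w. w @ [p]) ` W k q)"
    using finite_V fin by auto
  have "(A ^^ Suc k) root p = real (card (W (Suc k) p))" if p: "p \<in> V"
  proof -
    have "(\<lambda>w. w @ [p]) ` W k q \<subseteq> W (Suc k) p" if "path_tree_adj p q" for q
    proof
      fix w assume "w \<in> (\<lambda>w. w @ [p]) ` W k q"
      then obtain v where v: "w = v @ [p]" "v \<in> W k q" by auto
      then show "w \<in> W (Suc k) p"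
        using p path_tree_adj_sym[OF that]
        by (auto simp: W_def nth_append paths_in_def less_Suc_eq)
    qed
    with ext have "W (Suc k) p = (\<Union>q\<in>{q\<in>V. path_tree_adj p q}. (\<lambda>w. w @ [p]) ` W k q)" by blast
    then have "card (W (Suc k) p) = (\<Sum>q\<in>{q\<in>V. path_tree_adj p q}. card ((\<lambda>w. w @ [p]) ` W k q))"
      using finite_V fin by (simp only:) (subst card_UN_disjoint, auto simp: W_def)
    also have "\<dots> = (\<Sum>q\<in>{q\<in>V. path_tree_adj p q}. card (W k q))"
      by (intro sum.cong card_image) (auto simp: inj_on_def)
    finally have "real (card (W (Suc k) p)) = (\<Sum>q\<in>{q\<in>V. path_tree_adj p q}. real (card (W k q)))"
      by simp
    also have "\<dots> = (\<Sum>q\<in>{q\<in>V. path_tree_adj p q}. (A ^^ k) root q)"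
      using Suc by (intro sum.cong) auto
    also have "\<dots> = A ((A ^^ k) root) p" using p by (simp add: A_def)
    finally show ?thesis by simp
  qed
  then show ?case using finite_subset[OF ext fin_rhs] by blast
qed

lemma ip_opoly_root:
  assumes "\<And>p. p \<in> paths_from E u \<Longrightarrow> length p \<le> Suc N \<Longrightarrow> set p \<subseteq> S" "degree P \<le> N"
  shows "ip (opoly P root) root = moment_functional (path_tree_moment E u) P"
  unfolding ip_root opoly_def moment_functional_def path_tree_moment_def path_tree_closed_walks_def
  using power_A_root[OF assms(1), of N] root_in_V assms(2) by (intro sum.cong) auto

end

section \<open>The moment problem on an interval\<close>

text \<open>The ratio of binomials is the product of the (k - i) / (n - i) for i < j. Bernstein
  weights reproduce the averages of these ratios exactly, so this is the error for the ordinary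
  power of k / n.\<close>

lemma binomial_ratio_power_bound:
  assumes "k \<le> n" "j < n"
  shows "\<bar>(real k / real n) ^ j - real (k choose j) / real (n choose j)\<bar> \<le> (real j)\<^sup>2 / (real n - real j)"
  using assms(2)
proof (induction j)
  case 0
  then show ?case by simp
next
  case (Suc j)
  define y where "y = real k / real n"
  define c where "c i = real (k choose i) / real (n choose i)" for i
  define s where "s = (real k - real j) / (real n - real j)"
  have n: "0 < real n" "0 < real n - real j" "0 < real n - real (Suc j)" using Suc.prems by auto
  have y: "0 \<le> y" "y \<le> 1" using n assms(1) by (auto simp: y_def)
  have "c j \<le> 1" using binomial_right_mono[OF assms(1), of j] Suc.prems by (simp add: c_def)
  then have c: "0 \<le> c j" "c j \<le> 1" by (auto simp: c_def)
  have step: "real (Suc j) * real (m choose Suc j) = real (m choose j) * (real m - real j)" if "j \<le> m" for m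
  proof -
    have "Suc j * (m choose Suc j) = (m - j) * (m choose j)"
      using binomial_absorption[of j m] binomial_absorb_comp[of m j] by simp
    then have "real (Suc j * (m choose Suc j)) = real ((m - j) * (m choose j))" by (rule arg_cong)
    then show ?thesis using that by (simp only: of_nat_mult of_nat_diff mult.commute)
  qed
  have "c (Suc j) = c j * s"
  proof (cases "j \<le> k")
    case True
    have "c (Suc j) = (real (Suc j) * real (k choose Suc j)) / (real (Suc j) * real (n choose Suc j))"
      by (simp add: c_def)
    also have "\<dots> = c j * s" using Suc.prems True by (subst (1 2) step) (auto simp: c_def s_def)
    finally show ?thesis .
  next
    case False
    then show ?thesis by (simp add: c_def binomial_eq_0)
  qed
  \<comment> \<open>The new error is the old one plus the discrepancy between k / n and the next
    factor \<open>s\<close>, of size at most j / (n - j).\<close>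
  then have "y ^ Suc j - c (Suc j) = y * (y ^ j - c j) + c j * (y - s)" by (simp add: algebra_simps)
  then have "\<bar>y ^ Suc j - c (Suc j)\<bar> \<le> \<bar>y * (y ^ j - c j)\<bar> + \<bar>c j * (y - s)\<bar>" by simp
  also have "\<bar>y * (y ^ j - c j)\<bar> \<le> 1 * ((real j)\<^sup>2 / (real n - real j))"
    unfolding abs_mult using y Suc.IH Suc.prems by (intro mult_mono) (auto simp: y_def c_def)
  also have "\<bar>c j * (y - s)\<bar> \<le> 1 * (real j / (real n - real j))"
  proof -
    define v where "v = (real n - real k) / real n"
    have v: "0 \<le> v" "v \<le> 1" using n assms(1) by (auto simp: v_def field_simps)
    have "y - s = real j * v / (real n - real j)"
      using n by (simp add: y_def s_def v_def field_simps)
    then have "\<bar>y - s\<bar> = real j * v / (real n - real j)" using n v by simp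
    also have "\<dots> \<le> real j * 1 / (real n - real j)"
      using n v by (intro divide_right_mono mult_left_mono) auto
    finally have "\<bar>y - s\<bar> \<le> real j * 1 / (real n - real j)" .
    then show ?thesis unfolding abs_mult using c by (intro mult_mono) auto
  qed
  also have "1 * ((real j)\<^sup>2 / (real n - real j)) + 1 * (real j / (real n - real j))
      = ((real j)\<^sup>2 + real j) / (real n - real j)" by (simp add: add_divide_distrib)
  also have "\<dots> \<le> (real (Suc j))\<^sup>2 / (real n - real (Suc j))"
    using n by (intro frac_le) (auto simp: power2_eq_square algebra_simps)
  finally show ?case by (simp add: y_def c_def)
qed

text \<open>Hausdorff's positivity condition for a moment sequence on [-D, D].\<close>

locale positive_moments =
  fixes m :: "nat \<Rightarrow> real" and D :: real
  assumes D: "0 < D" and m0: "m 0 = 1"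
    and positive: "0 \<le> moment_functional m ([:D, -1:] ^ k * [:D, 1:] ^ l)"
begin

abbreviation "L \<equiv> moment_functional m"

text \<open>The affine coordinate carrying [-D, D] to [0, 1]; \<open>Y\<close> is its complement 1 -
  X.\<close>

definition X :: "real poly" where "X = smult (1 / (2 * D)) [:D, 1:]"
definition Y :: "real poly" where "Y = smult (1 / (2 * D)) [:D, -1:]"

lemma X_plus_Y: "X + Y = 1"
  using D by (simp add: X_def Y_def one_pCons field_simps)

lemma poly_X: "poly X x = (D + x) / (2 * D)"
  using D by (simp add: X_def add_divide_distrib)

text \<open>\<open>L\<close> applied to a Bernstein basis polynomial of degree \<open>n\<close>: the
  mass to be placed at the point where \<open>X\<close> equals k / n.\<close>

definition weight :: "nat \<Rightarrow> nat \<Rightarrow> real" where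
  "weight n k = real (n choose k) * L (X ^ k * Y ^ (n - k))"

lemma weight_nonneg: "0 \<le> weight n k"
proof -
  have "X ^ k * Y ^ l = smult ((1 / (2 * D)) ^ (l + k)) ([:D, -1:] ^ l * [:D, 1:] ^ k)" for l
    unfolding X_def Y_def smult_power by (simp add: power_add mult_ac)
  then show ?thesis using D by (simp add: weight_def moment_functional_smult positive)
qed

text \<open>Moving the binomials by C(n, k) C(k, j) = C(n, j) C(n - j, k - j) leaves X^j times the
  expansion of (X + Y)^(n - j) = 1.\<close>

lemma sum_weight_choose:
  assumes "j \<le> n"
  shows "(\<Sum>k\<le>n. weight n k * (real (k choose j) / real (n choose j))) = L (X ^ j)"
proof -
  have nz: "real (n choose j) \<noteq> 0" using assms by simp
  have "(\<Sum>k\<le>n. weight n k * (real (k choose j) / real (n choose j)))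
      = (\<Sum>k\<in>{j..n}. weight n k * (real (k choose j) / real (n choose j)))"
    by (intro sum.mono_neutral_right) (auto simp: not_le)
  also have "\<dots> = (\<Sum>k\<in>{j..n}. L (X ^ j * (of_nat ((n - j) choose (k - j)) * X ^ (k - j) * Y ^ (n - j - (k - j)))))"
  proof (rule sum.cong[OF refl])
    fix k assume k: "k \<in> {j..n}"
    then have "real (n choose k) * real (k choose j) = real (n choose j) * real ((n - j) choose (k - j))"
      using choose_mult[of j k n] by (metis atLeastAtMost_iff of_nat_mult)
    then have "weight n k * (real (k choose j) / real (n choose j)) =
        real ((n - j) choose (k - j)) * L (X ^ k * Y ^ (n - k))"
      using nz by (simp add: weight_def field_simps)
    also have "\<dots> = L (smult (real ((n - j) choose (k - j))) (X ^ k * Y ^ (n - k)))"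
      by (simp add: moment_functional_smult)
    also have "smult (real ((n - j) choose (k - j))) (X ^ k * Y ^ (n - k)) =
        X ^ j * (of_nat ((n - j) choose (k - j)) * X ^ (k - j) * Y ^ (n - j - (k - j)))"
    proof -
      have "X ^ k = X ^ j * X ^ (k - j)" using k by (simp add: power_add[symmetric])
      moreover have "n - j - (k - j) = n - k" using k by auto
      ultimately show ?thesis by (simp add: of_nat_poly mult_ac)
    qed
    finally show "weight n k * (real (k choose j) / real (n choose j)) =
      L (X ^ j * (of_nat ((n - j) choose (k - j)) * X ^ (k - j) * Y ^ (n - j - (k - j))))" .
  qed
  also have "\<dots> = (\<Sum>i\<le>n - j. L (X ^ j * (of_nat ((n - j) choose i) * X ^ i * Y ^ (n - j - i))))"
    using assms by (intro sum.reindex_bij_witness[of _ "\<lambda>i. i + j" "\<lambda>k. k - j"]) auto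
  also have "\<dots> = L (X ^ j * (X + Y) ^ (n - j))"
    unfolding moment_functional_sum[symmetric] sum_distrib_left[symmetric] binomial_ring ..
  finally show ?thesis by (simp add: X_plus_Y)
qed

lemma sum_weight: "(\<Sum>k\<le>n. weight n k) = 1"
  using sum_weight_choose[of 0 n] m0 by (simp add: moment_functional_def)

definition wpmf :: "nat \<Rightarrow> nat pmf" where
  "wpmf n = embed_pmf (\<lambda>k. if k \<le> n then weight n k else 0)"

lemma pmf_wpmf: "pmf (wpmf n) k = (if k \<le> n then weight n k else 0)"
  unfolding wpmf_def
proof (rule pmf_embed_pmf)
  have "(\<integral>\<^sup>+k. ennreal (if k \<le> n then weight n k else 0) \<partial>count_space UNIV)
     = (\<Sum>k\<le>n. ennreal (weight n k))"
    by (subst nn_integral_count_space'[of "{..n}"]) (auto intro: sum.cong)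
  also have "\<dots> = 1" using weight_nonneg by (simp add: sum_ennreal sum_weight)
  finally show "(\<integral>\<^sup>+k. ennreal (if k \<le> n then weight n k else 0) \<partial>count_space UNIV) = 1" .
qed (simp add: weight_nonneg)

definition node :: "nat \<Rightarrow> nat \<Rightarrow> real" where
  "node n k = D * (2 * (real k / real n) - 1)"

text \<open>The shift to \<open>Suc n\<close> avoids the division by 0 in
  \<open>node\<close>.\<close>

definition bernstein_measure :: "nat \<Rightarrow> real measure" where
  "bernstein_measure n = distr (measure_pmf (wpmf (Suc n))) borel (node (Suc n))"

lemma real_distribution_bernstein: "real_distribution (bernstein_measure n)"
  unfolding bernstein_measure_def by (intro prob_space.real_distribution_distr) (auto intro: measure_pmf.prob_space_axioms)

lemma integral_bernstein:
  fixes f :: "real \<Rightarrow> real"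
  assumes "f \<in> borel_measurable borel"
  shows "(\<integral>x. f x \<partial>bernstein_measure n) = (\<Sum>k\<le>Suc n. weight (Suc n) k * f (node (Suc n) k))"
proof -
  have "(\<integral>x. f x \<partial>bernstein_measure n) = (\<integral>k. f (node (Suc n) k) \<partial>measure_pmf (wpmf (Suc n)))"
    unfolding bernstein_measure_def using assms by (intro integral_distr) auto
  also have "\<dots> = (\<Sum>k\<le>Suc n. f (node (Suc n) k) * pmf (wpmf (Suc n)) k)"
    by (rule integral_measure_pmf_real) (auto simp: set_pmf_iff pmf_wpmf split: if_splits)
  finally show ?thesis by (simp add: pmf_wpmf mult.commute)
qed

lemma node_bounds:
  assumes "k \<le> Suc n"
  shows "\<bar>node (Suc n) k\<bar> \<le> D" "poly X (node (Suc n) k) = real k / real (Suc n)"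
proof -
  have "0 \<le> real k / real (Suc n)" "real k / real (Suc n) \<le> 1" using assms by auto
  then have "\<bar>2 * (real k / real (Suc n)) - 1\<bar> \<le> 1" by linarith
  then show "\<bar>node (Suc n) k\<bar> \<le> D"
    unfolding node_def abs_mult using D by (simp add: mult_left_le)
  have "poly X (D * (2 * y - 1)) = y" for y using D by (simp add: poly_X field_simps)
  then show "poly X (node (Suc n) k) = real k / real (Suc n)" unfolding node_def .
qed

lemma tight_bernstein: "tight bernstein_measure"
  unfolding tight_def
proof (intro conjI allI impI)
  fix e :: real assume e: "0 < e"
  \<comment> \<open>The left end is moved to - D - 1 because tightness uses intervals open on the
    left and \<open>- D\<close> is itself a node.\<close>
  have "measure (bernstein_measure n) {- D - 1<..D} = 1" for n
  proof -
    interpret real_distribution "bernstein_measure n" by (rule real_distribution_bernstein)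
    have "measure (bernstein_measure n) {- D - 1<..D} = (\<integral>x. indicator {- D - 1<..D} x \<partial>bernstein_measure n)"
      by simp
    also have "\<dots> = (\<Sum>k\<le>Suc n. weight (Suc n) k * indicator {- D - 1<..D} (node (Suc n) k))"
      by (rule integral_bernstein) simp
    also have "\<dots> = (\<Sum>k\<le>Suc n. weight (Suc n) k)"
      using node_bounds(1) by (intro sum.cong) (fastforce simp: abs_le_iff indicator_def)+
    finally show ?thesis using sum_weight[of "Suc n"] by simp
  qed
  then show "\<exists>a b. a < b \<and> (\<forall>n. 1 - e < measure (bernstein_measure n) {a<..b})"
    using e D by (intro exI[of _ "- D - 1"] exI[of _ D]) auto
qed (rule real_distribution_bernstein)

lemma bernstein_moments:
  "(\<lambda>n. \<Sum>k\<le>Suc n. weight (Suc n) k * (real k / real (Suc n)) ^ j) \<longlonglongrightarrow> L (X ^ j)"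
\<comment> \<open>The offset makes the degree N = n + j + 2, so that j < N and N - j = n +
  2.\<close>
proof (rule LIMSEQ_offset[of _ "Suc j"], rule LIM_zero_cancel, rule Lim_null_comparison)
  show "\<forall>\<^sub>F n in sequentially. norm ((\<Sum>k\<le>Suc (n + Suc j). weight (Suc (n + Suc j)) k * (real k / real (Suc (n + Suc j))) ^ j) - L (X ^ j))
     \<le> (real j)\<^sup>2 / (real (n + 2))"
  proof (intro always_eventually allI)
    fix n
    let ?N = "Suc (n + Suc j)"
    have j: "j \<le> ?N" by simp
    have "norm ((\<Sum>k\<le>?N. weight ?N k * (real k / real ?N) ^ j) - L (X ^ j))
      = \<bar>\<Sum>k\<le>?N. weight ?N k * ((real k / real ?N) ^ j - real (k choose j) / real (?N choose j))\<bar>"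
      by (simp only: sum_weight_choose[OF j, symmetric] right_diff_distrib sum_subtractf real_norm_def)
    also have "\<dots> \<le> (\<Sum>k\<le>?N. weight ?N k * ((real j)\<^sup>2 / real (n + 2)))"
    proof (rule order_trans[OF sum_abs], rule sum_mono)
      fix k assume "k \<in> {..?N}"
      then have "\<bar>(real k / real ?N) ^ j - real (k choose j) / real (?N choose j)\<bar> \<le> (real j)\<^sup>2 / (real ?N - real j)"
        by (intro binomial_ratio_power_bound) auto
      also have "real ?N - real j = real (n + 2)" by simp
      finally show "\<bar>weight ?N k * ((real k / real ?N) ^ j - real (k choose j) / real (?N choose j))\<bar>
         \<le> weight ?N k * ((real j)\<^sup>2 / real (n + 2))"
        unfolding abs_mult abs_of_nonneg[OF weight_nonneg] by (rule mult_left_mono[OF _ weight_nonneg])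
    qed
    also have "\<dots> = (real j)\<^sup>2 / real (n + 2)"
      by (simp only: sum_distrib_right[symmetric] sum_weight mult_1)
    finally show "norm ((\<Sum>k\<le>?N. weight ?N k * (real k / real ?N) ^ j) - L (X ^ j)) \<le> (real j)\<^sup>2 / real (n + 2)" .
  qed
  show "(\<lambda>n. (real j)\<^sup>2 / (real (n + 2))) \<longlonglongrightarrow> 0"
    by (rule LIMSEQ_ignore_initial_segment[OF lim_const_over_n])
qed

lemma L_monom: "L (monom 1 n) = m n"
proof -
  have "L (monom 1 n) = (\<Sum>i\<le>n. if i = n then m i else 0)"
    unfolding moment_functional_def by (intro sum.cong) (auto simp: degree_monom_eq)
  then show ?thesis by simp
qed

text \<open>Hausdorff's theorem. The Bernstein measures sit on a common interval, so a subsequence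
  converges weakly, and the limit has the right moments in the coordinate \<open>X\<close>.\<close>

theorem moment_measure_exists:
  obtains M where "real_distribution M" "AE x in M. \<bar>x\<bar> \<le> D" "\<And>n. (\<integral>x. x ^ n \<partial>M) = m n"
proof -
  obtain r M where r: "strict_mono r" and M: "real_distribution M"
    and conv: "weak_conv_m (bernstein_measure \<circ> id \<circ> r) M"
    using tight_imp_convergent_subsubsequence[OF tight_bernstein strict_mono_id] by auto
  interpret real_distribution M by (rule M)
  have lim: "(\<lambda>n. \<Sum>k\<le>Suc (r n). weight (Suc (r n)) k * f (node (Suc (r n)) k)) \<longlonglongrightarrow> (\<integral>x. f x \<partial>M)"
    if "\<And>x. isCont f x" "\<And>x. norm (f x) \<le> B" for f :: "real \<Rightarrow> real" and B
  proof -
    have "(\<lambda>n. \<integral>x. f x \<partial>(bernstein_measure \<circ> id \<circ> r) n) \<longlonglongrightarrow> (\<integral>x. f x \<partial>M)"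
      using real_distribution_bernstein that
      by (intro weak_conv_imp_integral_bdd_continuous_conv[OF _ M conv]) auto
    moreover have "f \<in> borel_measurable borel"
      using that(1) by (intro borel_measurable_continuous_onI continuous_at_imp_continuous_on) auto
    ultimately show ?thesis by (simp add: integral_bernstein)
  qed
  have supp: "AE x in M. \<bar>x\<bar> \<le> D"
  proof -
    \<comment> \<open>A bounded continuous function vanishing exactly on [-D, D], hence at all
      nodes.\<close>
    let ?f = "\<lambda>x::real. min 1 (max 0 (\<bar>x\<bar> - D))"
    have "(\<lambda>n. \<Sum>k\<le>Suc (r n). weight (Suc (r n)) k * ?f (node (Suc (r n)) k)) \<longlonglongrightarrow> (\<integral>x. ?f x \<partial>M)"
      by (rule lim[of _ 1]) (auto intro!: continuous_intros)
    moreover have "(\<Sum>k\<le>Suc (r n). weight (Suc (r n)) k * ?f (node (Suc (r n)) k)) = 0" for n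
    proof (rule sum.neutral, rule ballI)
      fix k assume "k \<in> {..Suc (r n)}"
      then have "max 0 (\<bar>node (Suc (r n)) k\<bar> - D) = 0" using node_bounds(1)[of k "r n"] by simp
      then show "weight (Suc (r n)) k * ?f (node (Suc (r n)) k) = 0" by simp
    qed
    ultimately have "(\<lambda>n. 0) \<longlonglongrightarrow> (\<integral>x. ?f x \<partial>M)" by (simp only:)
    then have "(\<integral>x. ?f x \<partial>M) = 0" by (simp add: LIMSEQ_const_iff)
    moreover have "integrable M ?f" by (rule integrable_const_bound[of _ 1]) auto
    ultimately have "AE x in M. ?f x = 0"
      by (subst (asm) integral_nonneg_eq_0_iff_AE) auto
    then show ?thesis by eventually_elim (auto simp: max_def min_def split: if_splits)
  qed
  have X: "0 \<le> poly X x \<and> poly X x \<le> 1" if "\<bar>x\<bar> \<le> D" for x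
    using that D by (auto simp: poly_X field_simps abs_le_iff)
  have intX: "integrable M (\<lambda>x. poly X x ^ j)" for j
    using supp by (intro integrable_const_bound[of _ 1]) (auto simp: poly_X[abs_def] elim!: eventually_mono dest!: X intro!: power_le_one)
  have momX: "(\<integral>x. poly X x ^ j \<partial>M) = L (X ^ j)" for j
  proof -
    \<comment> \<open>Clamping to [0, 1] makes the power of \<open>X\<close> bounded on the whole
      line without changing it on the support.\<close>
    let ?f = "\<lambda>x. (min 1 (max 0 (poly X x))) ^ j"
    have "(\<lambda>n. \<Sum>k\<le>Suc (r n). weight (Suc (r n)) k * ?f (node (Suc (r n)) k)) \<longlonglongrightarrow> (\<integral>x. ?f x \<partial>M)"
      by (rule lim[of _ 1]) (auto intro!: continuous_intros power_le_one simp: power_abs)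
    moreover have "(\<Sum>k\<le>Suc (r n). weight (Suc (r n)) k * ?f (node (Suc (r n)) k))
       = (\<Sum>k\<le>Suc (r n). weight (Suc (r n)) k * (real k / real (Suc (r n))) ^ j)" for n
      by (intro sum.cong refl) (simp add: node_bounds(2) max_def min_def del: of_nat_Suc)
    ultimately have "(\<lambda>n. \<Sum>k\<le>Suc (r n). weight (Suc (r n)) k * (real k / real (Suc (r n))) ^ j)
        \<longlonglongrightarrow> (\<integral>x. ?f x \<partial>M)" by simp
    moreover have "(\<lambda>n. \<Sum>k\<le>Suc (r n). weight (Suc (r n)) k * (real k / real (Suc (r n))) ^ j) \<longlonglongrightarrow> L (X ^ j)"
      using LIMSEQ_subseq_LIMSEQ[OF bernstein_moments r] by (simp only: comp_def)
    ultimately have "L (X ^ j) = (\<integral>x. ?f x \<partial>M)" by (rule LIMSEQ_unique[rotated])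
    also have "\<dots> = (\<integral>x. poly X x ^ j \<partial>M)"
      using supp by (intro integral_cong_AE) (auto simp: poly_X[abs_def] elim!: eventually_mono dest!: X)
    finally show ?thesis ..
  qed
  have "(\<integral>x. x ^ n \<partial>M) = m n" for n
  proof -
    \<comment> \<open>Back from \<open>X\<close> to the original variable by x = 2 D X - D.\<close>
    have "monom 1 n = (smult (2 * D) X + [:- D:]) ^ n"
      using D by (simp add: X_def monom_altdef)
    also have "\<dots> = (\<Sum>k\<le>n. smult (real (n choose k) * (2 * D) ^ k * (- D) ^ (n - k)) (X ^ k))"
      unfolding binomial_ring by (intro sum.cong) (simp_all add: of_nat_poly smult_power poly_const_pow mult_ac)
    finally have "m n = (\<Sum>k\<le>n. real (n choose k) * (2 * D) ^ k * (- D) ^ (n - k) * L (X ^ k))"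
      using moment_functional_sum moment_functional_smult
      by (metis (no_types, lifting) L_monom sum.cong)
    also have "\<dots> = (\<Sum>k\<le>n. \<integral>x. real (n choose k) * (2 * D) ^ k * (- D) ^ (n - k) * poly X x ^ k \<partial>M)"
      by (simp add: momX)
    also have "\<dots> = (\<integral>x. (\<Sum>k\<le>n. real (n choose k) * (2 * D) ^ k * (- D) ^ (n - k) * poly X x ^ k) \<partial>M)"
      using intX by (intro Bochner_Integration.integral_sum[symmetric]) auto
    also have "\<dots> = (\<integral>x. (2 * D * poly X x + (- D)) ^ n \<partial>M)"
      unfolding binomial_ring by (simp add: power_mult_distrib mult_ac)
    also have "\<dots> = (\<integral>x. x ^ n \<partial>M)" using D by (simp add: poly_X)
    finally show ?thesis ..
  qed
  then show thesis using that M supp by blast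
qed

end

section \<open>Matching measures\<close>

lemma real_poly_approx:
  fixes f :: "real \<Rightarrow> real"
  assumes "continuous_on UNIV f" "0 < e"
  obtains p where "\<And>x. \<bar>x\<bar> \<le> D \<Longrightarrow> \<bar>f x - poly p x\<bar> \<le> e"
proof -
  have c: "continuous_on {-D..D} f" by (rule continuous_on_subset[OF assms(1)]) simp
  show thesis
  proof (rule Stone_Weierstrass_real_polynomial_function[OF compact_Icc c assms(2)])
    fix g assume "real_polynomial_function g" and g: "\<And>x. x \<in> {-D..D} \<Longrightarrow> \<bar>f x - g x\<bar> < e"
    then obtain a n where "g = (\<lambda>x. \<Sum>i\<le>n. a i * x ^ i)" by (auto simp: real_polynomial_function_iff_sum)
    then have p: "poly (\<Sum>i\<le>n. monom (a i) i) x = g x" for x by (simp add: poly_sum poly_monom)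
    show thesis
    proof (rule that)
      fix x assume "\<bar>x\<bar> \<le> D"
      then have "x \<in> {-D..D}" by auto
      then show "\<bar>f x - poly (\<Sum>i\<le>n. monom (a i) i) x\<bar> \<le> e" unfolding p by (rule less_imp_le[OF g])
    qed
  qed
qed

locale bounded_distribution = real_distribution +
  fixes D :: real
  assumes support: "AE x in M. \<bar>x\<bar> \<le> D"
begin

lemma integrable_continuous:
  fixes f :: "real \<Rightarrow> real"
  assumes f: "continuous_on UNIV f"
  shows "integrable M f"
proof -
  have "compact (f ` {-D..D})"
    by (rule compact_continuous_image) (auto intro: continuous_on_subset[OF f])
  then obtain B where B: "\<And>x. x \<in> {-D..D} \<Longrightarrow> norm (f x) \<le> B"
    using compact_imp_bounded by (metis bounded_iff imageI)
  have "AE x in M. norm (f x) \<le> B" using support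
  proof eventually_elim
    case (elim x)
    then show ?case by (intro B) auto
  qed
  then show ?thesis using borel_measurable_continuous_onI[OF f] by (intro integrable_const_bound) auto
qed

lemma integral_poly: "(\<integral>x. poly p x \<partial>M) = moment_functional (\<lambda>n. \<integral>x. x ^ n \<partial>M) p"
  unfolding poly_altdef moment_functional_def
  by (subst Bochner_Integration.integral_sum) (auto intro!: integrable_continuous continuous_intros)

lemma integral_continuous_mono:
  fixes f g :: "real \<Rightarrow> real"
  assumes "continuous_on UNIV f" "continuous_on UNIV g" "\<And>x. \<bar>x\<bar> \<le> D \<Longrightarrow> f x \<le> g x"
  shows "(\<integral>x. f x \<partial>M) \<le> (\<integral>x. g x \<partial>M)"
  using support assms by (intro integral_mono_AE integrable_continuous) (auto elim!: eventually_mono)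

end

text \<open>Moments determine integrals of polynomials, hence by uniform approximation on the
  support those of all continuous functions, in particular the characteristic function.\<close>

lemma bounded_distribution_unique:
  assumes "bounded_distribution M D" "bounded_distribution N D"
    and mom: "\<And>n. (\<integral>x. x ^ n \<partial>M) = (\<integral>x. x ^ n \<partial>N)"
  shows "M = N"
proof -
  interpret M: bounded_distribution M D by fact
  interpret N: bounded_distribution N D by fact
  have le: "(\<integral>x. f x \<partial>M') \<le> (\<integral>x. f x \<partial>N')"
    if f: "continuous_on UNIV f" and "bounded_distribution M' D" "bounded_distribution N' D"
      and mom: "\<And>n. (\<integral>x. x ^ n \<partial>M') = (\<integral>x. x ^ n \<partial>N')" for f :: "real \<Rightarrow> real" and M' N'
  proof (rule field_le_epsilon)
    fix e :: real assume "0 < e"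
    interpret M': bounded_distribution M' D by fact
    interpret N': bounded_distribution N' D by fact
    obtain p where p: "\<And>x. \<bar>x\<bar> \<le> D \<Longrightarrow> \<bar>f x - poly p x\<bar> \<le> e / 2"
      using real_poly_approx[OF f, of "e / 2" D] \<open>0 < e\<close> by auto
    have p': "f x \<le> poly p x + e / 2" "poly p x + e / 2 \<le> f x + e" if "\<bar>x\<bar> \<le> D" for x
      using p[OF that] by linarith+
    have "(\<integral>x. f x \<partial>M') \<le> (\<integral>x. poly (p + [:e / 2:]) x \<partial>M')"
      using p' by (intro M'.integral_continuous_mono f continuous_intros) simp
    also have "\<dots> = (\<integral>x. poly (p + [:e / 2:]) x \<partial>N')"
      unfolding M'.integral_poly N'.integral_poly mom ..
    also have "\<dots> \<le> (\<integral>x. f x + e \<partial>N')"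
      using p' by (intro N'.integral_continuous_mono f continuous_intros) simp
    also have "\<dots> = (\<integral>x. f x \<partial>N') + e"
      using N'.integrable_continuous[OF f] by (simp del: N'.space_eq_univ add: N'.prob_space)
    finally show "(\<integral>x. f x \<partial>M') \<le> (\<integral>x. f x \<partial>N') + e" .
  qed
  have eq: "(\<integral>x. f x \<partial>M) = (\<integral>x. f x \<partial>N)" if "continuous_on UNIV f" for f :: "real \<Rightarrow> real"
    using le[OF that assms(1,2) mom] le[OF that assms(2,1) mom[symmetric]] by simp
  have "char M t = char N t" for t
  proof -
    \<comment> \<open>The approximation is for real functions, so the complex exponential is tested
      through its real and imaginary parts.\<close>
    have "T (char M t) = T (char N t)" if T: "bounded_linear T" for T :: "complex \<Rightarrow> real"
    proof -
      have "T (char M t) = (\<integral>x. T (iexp (t * x)) \<partial>M)"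
        unfolding char_def by (rule integral_bounded_linear[OF T, symmetric]) (rule M.integrable_iexp, auto)
      also have "\<dots> = (\<integral>x. T (iexp (t * x)) \<partial>N)"
        by (intro eq bounded_linear.continuous_on[OF T] continuous_intros)
      also have "\<dots> = T (char N t)"
        unfolding char_def by (rule integral_bounded_linear[OF T]) (rule N.integrable_iexp, auto)
      finally show ?thesis .
    qed
    then show ?thesis using bounded_linear_Re bounded_linear_Im by (intro complex_eqI) blast+
  qed
  then show ?thesis
    using Levy_uniqueness[OF M.real_distribution_axioms N.real_distribution_axioms] by blast
qed

section \<open>Moments, existence and uniqueness of the matching measure\<close>

lemma finite_path_tree_short_paths:
  assumes E: "simple_graph E" "degree_bounded E D"
  obtains S0 where "finite S0"
    "\<And>S. finite S \<Longrightarrow> S0 \<subseteq> S \<Longrightarrow> finite_path_tree E S D u"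
    "\<And>S p. S0 \<subseteq> S \<Longrightarrow> p \<in> paths_from E u \<Longrightarrow> length p \<le> Suc N \<Longrightarrow> set p \<subseteq> S"
proof -
  let ?S = "insert u (\<Union>p\<in>{p \<in> paths_from E u. length p \<le> Suc N}. set p)"
  have "finite ?S" using finite_short_paths[OF E(2)] by auto
  moreover have "finite_path_tree E S D u" if "finite S" "?S \<subseteq> S" for S
    using that E by unfold_locales auto
  ultimately show thesis by (intro that[of ?S]) auto
qed

lemma positive_path_tree_moments:
  assumes E: "simple_graph E" "degree_bounded E D" and D: "0 < D"
  shows "positive_moments (path_tree_moment E u) (real D)"
proof
  \<comment> \<open>A polynomial involves finitely many moments, so a finite tree is chosen for each
    degree bound \<open>N\<close>; no single tree serves all of them.\<close>
  have L: "\<exists>S. finite_path_tree E S D u \<and> (\<forall>P. degree P \<le> N \<longrightarrow>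
      finite_adjacency.ip (paths_in E S u) (finite_adjacency.opoly (paths_in E S u) path_tree_adj P (finite_path_tree.root u)) (finite_path_tree.root u)
      = moment_functional (path_tree_moment E u) P)" for N
  proof -
    obtain S where "finite S" "finite_path_tree E S D u"
      and short: "\<And>p. p \<in> paths_from E u \<Longrightarrow> length p \<le> Suc N \<Longrightarrow> set p \<subseteq> S"
      using finite_path_tree_short_paths[OF E] by (metis subset_refl)
    then show ?thesis using finite_path_tree.ip_opoly_root[of E S D u N] by blast
  qed
  show "path_tree_moment E u 0 = 1"
  proof -
    obtain S where S: "finite_path_tree E S D u" and *: "\<And>P. degree P \<le> 0 \<Longrightarrow>
      finite_adjacency.ip (paths_in E S u) (finite_adjacency.opoly (paths_in E S u) path_tree_adj P (finite_path_tree.root u)) (finite_path_tree.root u)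
      = moment_functional (path_tree_moment E u) P" using L by blast
    interpret finite_path_tree E S D u by (rule S)
    show ?thesis using *[of 1] by (simp add: ip_root root_def moment_functional_def)
  qed
  fix k l
  let ?P = "[:real D, - 1:] ^ k * [:real D, 1:] ^ l"
  obtain S where S: "finite_path_tree E S D u" and *: "\<And>P. degree P \<le> degree ?P \<Longrightarrow>
      finite_adjacency.ip (paths_in E S u) (finite_adjacency.opoly (paths_in E S u) path_tree_adj P (finite_path_tree.root u)) (finite_path_tree.root u)
      = moment_functional (path_tree_moment E u) P" using L by blast
  interpret finite_path_tree E S D u by (rule S)
  show "0 \<le> moment_functional (path_tree_moment E u) ?P"
    unfolding *[OF order_refl, symmetric] by (rule ip_opoly_nonneg[OF D])
qed (use D in simp)

text \<open>The condition inside \<open>matching_measure\<close> with the support expressed almost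
  everywhere and the moment of order 0 included, as the moment problem delivers it.\<close>

definition is_matching_measure :: "('a \<Rightarrow> 'a \<Rightarrow> bool) \<Rightarrow> nat \<Rightarrow> 'a \<Rightarrow> real measure \<Rightarrow> bool" where
  "is_matching_measure E D u M \<longleftrightarrow> bounded_distribution M (real D) \<and>
    (\<forall>n. (\<integral>x. x ^ n \<partial>M) = path_tree_moment E u n)"

text \<open>The definite description is justified by existence from
  \<open>moment_measure_exists\<close> and uniqueness from
  \<open>bounded_distribution_unique\<close>.\<close>

lemma is_matching_measure_matching_measure:
  assumes E: "simple_graph E" "degree_bounded E D" and D: "0 < D"
  shows "is_matching_measure E D u (matching_measure E D u)"
proof -
  interpret positive_moments "path_tree_moment E u" "real D"
    using positive_path_tree_moments[OF assms] .
  have iff: "(prob_space M \<and> sets M = sets borel \<and> emeasure M {- real D .. real D} = 1 \<and>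
      (\<forall>n\<ge>1. (\<integral>x. x ^ n \<partial>M) = path_tree_moment E u n)) \<longleftrightarrow> is_matching_measure E D u M" (is "?L M \<longleftrightarrow> _") for M
  proof
    assume L: "?L M"
    interpret prob_space M using L by simp
    interpret real_distribution M using L by unfold_locales auto
    have "AE x in M. x \<in> {- real D .. real D}"
      using L by (intro AE_prob_1) (simp add: emeasure_eq_measure)
    then have "AE x in M. \<bar>x\<bar> \<le> real D" by eventually_elim auto
    then have "bounded_distribution M (real D)" by unfold_locales
    moreover have "(\<integral>x. x ^ n \<partial>M) = path_tree_moment E u n" for n
      using L by (cases "n = 0") (simp_all del: space_eq_univ add: m0 prob_space)
    ultimately show "is_matching_measure E D u M" by (simp add: is_matching_measure_def)
  next
    assume R: "is_matching_measure E D u M"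
    then interpret bounded_distribution M "real D" by (simp add: is_matching_measure_def)
    have "AE x in M. x \<in> {- real D .. real D}" using support by eventually_elim auto
    then have "prob {- real D .. real D} = 1" by (subst prob_eq_1) auto
    then show "?L M"
      using R prob_space_axioms by (simp add: is_matching_measure_def emeasure_eq_measure)
  qed
  obtain M where "is_matching_measure E D u M"
    using moment_measure_exists
    by (auto simp: is_matching_measure_def bounded_distribution_def bounded_distribution_axioms_def)
  then have "\<exists>!M. is_matching_measure E D u M"
  proof (rule ex1I)
    fix N assume "is_matching_measure E D u N"
    with \<open>is_matching_measure E D u M\<close> show "N = M"
      by (intro bounded_distribution_unique[of N "real D" M]) (simp_all add: is_matching_measure_def)
  qed
  then show ?thesis unfolding matching_measure_def iff by (rule theI')
qed

text \<open>The polynomial \<open>q\<close> approximates \<open>1 / ((x - \<theta>)\<^sup>2 + t\<^sup>2)\<close> on \<open>[-D, D]\<close>; only the finitely many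
  moments entering \<open>q\<close> are compared, and these agree for a large finite subgraph.\<close>

lemma atom_le_green:
  assumes E: "simple_graph E" "degree_bounded E D"
    and M: "is_matching_measure E D u M" and t: "0 < t" and e: "0 < e"
  shows "\<forall>\<^sub>F S in finite_subsets_at_top UNIV. measure M {\<theta>} - e \<le> t * - Im (green E (Complex \<theta> t) S u)"
proof -
  interpret bounded_distribution M "real D" using M by (simp add: is_matching_measure_def)
  have mom: "(\<lambda>n. \<integral>x. x ^ n \<partial>M) = path_tree_moment E u" using M by (auto simp: is_matching_measure_def)
  define w where "w = [:\<theta>\<^sup>2 + t\<^sup>2, - 2 * \<theta>, 1:]"
  have w: "poly w x = (x - \<theta>)\<^sup>2 + t\<^sup>2" for x by (simp add: w_def power2_eq_square algebra_simps)
  have wt: "t\<^sup>2 \<le> poly w x" for x by (simp add: w)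
  have w0: "0 < poly w x" for x using wt[of x] t by (smt (verit) zero_less_power)
  define B where "B = (real D + \<bar>\<theta>\<bar>)\<^sup>2 + t\<^sup>2"
  have wB: "poly w x \<le> B" if "\<bar>x\<bar> \<le> real D" for x
  proof -
    have "\<bar>x - \<theta>\<bar> \<le> real D + \<bar>\<theta>\<bar>" using that by linarith
    then have "(x - \<theta>)\<^sup>2 \<le> (real D + \<bar>\<theta>\<bar>)\<^sup>2" by (metis abs_ge_zero power2_abs power_mono)
    then show ?thesis by (simp add: w B_def)
  qed
  have B: "0 < B" "t\<^sup>2 \<le> B" using t by (simp_all add: B_def add_nonneg_pos)
  \<comment> \<open>Two errors are at most B d each, t^2 d from the integral and B d from the
    resolvent, so together they stay within e.\<close>
  define d where "d = e / (2 * B)"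
  have d: "0 < d" using e B by (simp add: d_def)
  have cont: "continuous_on UNIV (\<lambda>x. 1 / poly w x)" using w0 by (intro continuous_intros) (metis less_irrefl)
  obtain q where q: "\<And>x. \<bar>x\<bar> \<le> real D \<Longrightarrow> \<bar>1 / poly w x - poly q x\<bar> \<le> d"
    using real_poly_approx[OF cont d] by blast
  define N where "N = max (degree q) (degree ((w * q - 1) * (w * q - 1)))"
  \<comment> \<open>The function t^2 / w is 1 at \<theta> and nonnegative elsewhere.\<close>
  have "measure M {\<theta>} = (\<integral>x. indicator {\<theta>} x \<partial>M)" by simp
  also have "\<dots> \<le> (\<integral>x. t\<^sup>2 * (1 / poly w x) \<partial>M)"
  proof (rule integral_mono)
    show "integrable M (indicat_real {\<theta>})" by (intro integrable_const_bound[of _ 1]) auto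
    show "integrable M (\<lambda>x. t\<^sup>2 * (1 / poly w x))"
      by (intro integrable_continuous continuous_on_mult cont continuous_on_const)
    show "indicat_real {\<theta>} x \<le> t\<^sup>2 * (1 / poly w x)" for x
      using t w0[of x] by (simp add: indicator_def w)
  qed
  also have "\<dots> \<le> (\<integral>x. poly (smult (t\<^sup>2) q + [:t\<^sup>2 * d:]) x \<partial>M)"
  proof (rule integral_continuous_mono)
    fix x :: real assume "\<bar>x\<bar> \<le> real D"
    then have "1 / poly w x \<le> poly q x + d" using q by (smt (verit))
    then have "t\<^sup>2 * (1 / poly w x) \<le> t\<^sup>2 * (poly q x + d)" by (rule mult_left_mono) simp
    then show "t\<^sup>2 * (1 / poly w x) \<le> poly (smult (t\<^sup>2) q + [:t\<^sup>2 * d:]) x" by (simp add: distrib_left)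
  qed (intro continuous_on_mult cont continuous_on_const continuous_intros)+
  also have "\<dots> = t\<^sup>2 * (\<integral>x. poly q x \<partial>M) + t\<^sup>2 * d"
    by (simp del: space_eq_univ add: integrable_continuous continuous_intros prob_space)
  also have "(\<integral>x. poly q x \<partial>M) = moment_functional (path_tree_moment E u) q"
    by (simp add: integral_poly mom)
  finally have atom: "measure M {\<theta>} \<le> t\<^sup>2 * moment_functional (path_tree_moment E u) q + t\<^sup>2 * d" .
  \<comment> \<open>On the support |w q - 1| = w |1 / w - q| \<le> B d. Its square is a polynomial,
    so this bound passes to the finite trees through moments alone.\<close>
  have "moment_functional (path_tree_moment E u) ((w * q - 1) * (w * q - 1)) =
      (\<integral>x. poly ((w * q - 1) * (w * q - 1)) x \<partial>M)" by (simp only: integral_poly mom)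
  also have "\<dots> \<le> (\<integral>x. (B * d)\<^sup>2 \<partial>M)"
  proof (rule integral_continuous_mono)
    fix x :: real assume x: "\<bar>x\<bar> \<le> real D"
    have "poly (w * q - 1) x = - (poly w x * (1 / poly w x - poly q x))"
      using w0[of x] by (simp add: right_diff_distrib)
    then have "\<bar>poly (w * q - 1) x\<bar> = poly w x * \<bar>1 / poly w x - poly q x\<bar>"
      using w0[of x] by (simp only: abs_minus_cancel abs_mult abs_of_pos)
    also have "\<dots> \<le> B * d" using wB[OF x] q[OF x] w0[of x] B by (intro mult_mono) auto
    finally have "\<bar>poly (w * q - 1) x\<bar>\<^sup>2 \<le> (B * d)\<^sup>2" by (rule power_mono) simp
    then show "poly ((w * q - 1) * (w * q - 1)) x \<le> (B * d)\<^sup>2" by (simp only: poly_mult power2_abs power2_eq_square)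
  qed (intro continuous_intros)+
  also have "\<dots> = (B * d)\<^sup>2" by (simp del: space_eq_univ add: prob_space)
  finally have sq: "moment_functional (path_tree_moment E u) ((w * q - 1) * (w * q - 1)) \<le> (B * d)\<^sup>2" .
  obtain S0 where "finite S0" and tree: "\<And>S. finite S \<Longrightarrow> S0 \<subseteq> S \<Longrightarrow> finite_path_tree E S D u"
    and short: "\<And>S p. S0 \<subseteq> S \<Longrightarrow> p \<in> paths_from E u \<Longrightarrow> length p \<le> Suc N \<Longrightarrow> set p \<subseteq> S"
    using finite_path_tree_short_paths[OF E] by metis
  have "measure M {\<theta>} - e \<le> t * - Im (green E (Complex \<theta> t) S u)" if S: "finite S" "S0 \<subseteq> S" for S
  proof -
    interpret finite_path_tree E S D u using tree[OF S] .
    obtain h where h: "opoly w h = root" "ip h root = - Im (green E (Complex \<theta> t) S u) / t"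
      using green_resolvent[OF t] unfolding w_def by blast
    have ip: "ip (opoly P root) root = moment_functional (path_tree_moment E u) P" if "degree P \<le> N" for P
      using ip_opoly_root[OF short[OF S(2)] that] by blast
    have n: "degree ((w * q - 1) * (w * q - 1)) \<le> N" by (simp only: N_def max.cobounded2)
    have "t\<^sup>2 * \<bar>ip (opoly q root) root - ip h root\<bar> \<le>
        sqrt (ip (opoly ((w * q - 1) * (w * q - 1)) root) root) * sqrt (ip root root)"
      using resolvent_approx[OF t, of \<theta> h root q] h(1) unfolding w_def by blast
    also have "\<dots> \<le> sqrt ((B * d)\<^sup>2)"
      unfolding ip[OF n] ip_root(2) by (simp only: real_sqrt_one mult_1_right real_sqrt_le_iff sq)
    also have "\<dots> = B * d" using B d by simp
    finally have "t\<^sup>2 * \<bar>moment_functional (path_tree_moment E u) q - ip h root\<bar> \<le> B * d"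
      using ip[of q] by (simp add: N_def)
    then have "\<bar>t\<^sup>2 * moment_functional (path_tree_moment E u) q - t\<^sup>2 * ip h root\<bar> \<le> B * d"
      by (simp add: abs_mult right_diff_distrib[symmetric])
    then have "measure M {\<theta>} \<le> t\<^sup>2 * ip h root + B * d + t\<^sup>2 * d" using atom by linarith
    also have "t\<^sup>2 * d \<le> B * d" using B d by (intro mult_right_mono) auto
    also have "t\<^sup>2 * ip h root = t * - Im (green E (Complex \<theta> t) S u)"
      using t by (simp add: h(2) power2_eq_square)
    finally have "measure M {\<theta>} \<le> t * - Im (green E (Complex \<theta> t) S u) + B * d + B * d" by simp
    moreover have "B * d + B * d = e" using B by (simp add: d_def)
    ultimately show ?thesis by linarith
  qed
  then show ?thesis unfolding eventually_finite_subsets_at_top using \<open>finite S0\<close> by blast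
qed

section \<open>Invariance under automorphisms and the conclusion\<close>

lemma automorphism_paths_from:
  assumes "graph_automorphism E f" "p \<in> paths_from E u"
  shows "map f p \<in> paths_from E (f u)"
  using assms by (auto simp: graph_automorphism_def paths_from_def hd_map distinct_map bij_def
      intro: inj_on_subset)

lemma automorphism_closed_walks:
  assumes f: "graph_automorphism E f" and w: "w \<in> path_tree_closed_walks E u n"
  shows "map (map f) w \<in> path_tree_closed_walks E (f u) n"
proof -
  have "path_tree_adj (map f p) (map f q)" if "path_tree_adj p q" for p q
    using that by (auto simp: path_tree_adj_def)
  then show ?thesis
    using w automorphism_paths_from[OF f] by (auto simp: path_tree_closed_walks_def)
qed

lemma automorphism_path_tree_moment:
  assumes f: "graph_automorphism E f"
  shows "path_tree_moment E (f u) = path_tree_moment E u"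
proof
  fix n
  have b: "bij f" using f by (simp add: graph_automorphism_def)
  have "E (inv f x) (inv f y) \<longleftrightarrow> E (f (inv f x)) (f (inv f y))" for x y
    using f unfolding graph_automorphism_def by blast
  then have g: "graph_automorphism E (inv f)"
    using bij_imp_bij_inv[OF b] bij_is_surj[OF b] by (simp add: graph_automorphism_def surj_f_inv_f)
  have i: "map (inv f) (map f p) = p" "map f (map (inv f) p) = p" for p
    using bij_is_inj[OF b] bij_is_surj[OF b] by (simp_all add: map_idI surj_f_inv_f)
  have inv: "map (map (inv f)) (map (map f) w) = w" "map (map f) (map (map (inv f)) w) = w" for w
    by (induction w) (simp_all add: i del: map_map)
  have "bij_betw (map (map f)) (path_tree_closed_walks E u n) (path_tree_closed_walks E (f u) n)"
  proof (rule bij_betw_byWitness[of _ "map (map (inv f))"])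
    show "map (map f) ` path_tree_closed_walks E u n \<subseteq> path_tree_closed_walks E (f u) n"
      using automorphism_closed_walks[OF f] by blast
    show "map (map (inv f)) ` path_tree_closed_walks E (f u) n \<subseteq> path_tree_closed_walks E u n"
      using automorphism_closed_walks[OF g, of _ "f u" n] inv_f_f[OF bij_is_inj[OF b]] by auto
  qed (use inv in blast)+
  then show "path_tree_moment E (f u) n = path_tree_moment E u n"
    by (simp add: path_tree_moment_def bij_betw_same_card)
qed

theorem theorem1p1:
  fixes E :: "'a \<Rightarrow> 'a \<Rightarrow> bool" and D :: nat and u :: 'a
  assumes "simple_graph E"
    and "infinite (UNIV :: 'a set)"
    and "connected_graph E"
    and "vertex_transitive E"
    and "degree_bounded E D"
  shows "\<forall>\<theta>::real. measure (matching_measure E D u) {\<theta>} = 0"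
proof (rule allI, rule ccontr)
  fix \<theta> :: real
  define M where "M = matching_measure E D u"
  define c where "c = measure M {\<theta>}"
  assume "measure (matching_measure E D u) {\<theta>} \<noteq> 0"
  then have c: "0 < c" using zero_less_measure_iff by (metis M_def c_def)
  \<comment> \<open>With D = 0 there are no edges, and a connected graph would have a single vertex;
    a positive D is what allows rescaling [-D, D] to [0, 1].\<close>
  have D: "0 < D"
  proof (rule ccontr)
    assume "\<not> 0 < D"
    then have "finite {y. E x y}" "card {y. E x y} = 0" for x
      using assms(5) by (auto simp: degree_bounded_def)
    then have no_edge: "\<not> E x y" for x y by (metis card_0_eq emptyE mem_Collect_eq)
    have "y = u" for y
      using assms(3) no_edge unfolding connected_graph_def by (metis rtranclp.cases)
    then have "(UNIV :: 'a set) = {u}" by auto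
    then show False using assms(2) by (metis finite.emptyI finite.insertI)
  qed
  \<comment> \<open>Transitivity is used here: all vertices have the same moments, so one measure
    with one atom serves every vertex.\<close>
  have "is_matching_measure E D x M" for x
  proof -
    obtain f where "graph_automorphism E f" "f u = x"
      using assms(4) by (auto simp: vertex_transitive_def)
    then have "path_tree_moment E x = path_tree_moment E u" using automorphism_path_tree_moment by metis
    then show ?thesis
      using is_matching_measure_matching_measure[OF assms(1,5) D, of u]
      by (simp add: is_matching_measure_def M_def)
  qed
  \<comment> \<open>Half of the mass is given up as the error term of
    \<open>atom_le_green\<close>.\<close>
  then have "iterated_eventually (\<lambda>t S. c / 2 \<le> t * - Im (green E (Complex \<theta> t) S x))" for x
    unfolding iterated_eventually_def
    using atom_le_green[OF assms(1,5), of x M _ "c / 2" \<theta>] c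
    by (intro eventually_mono[OF eventually_at_right_less[of 0]]) (simp add: c_def)
  then show False
    using green_lower_bound_contradiction[OF assms(1-3), of "c / 2" \<theta>] c by simp
qed

end
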